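(* Consider the system $\dot x=f(x)$, $y=h(x)$, with $f:\mathbb{R}^{n_x}\to\mathbb{R}^{n_x}$ and $h:\mathbb{R}^{n_x}\to\mathbb{R}^{n_y}$ real analytic. Let $\mathcal{O}\subset\mathbb{R}^{n_x}$, let $T:\mathcal{O}\to\mathbb{R}^{n_z}$ be $C^1$, and let $\mathcal{X}\subset\mathcal{O}$ be compact. For $z\in T(\mathcal{X})$ let $T^-(z):=\{x\in\mathcal{X}:T(x)=z\}$. Assume that: (A1) there exists an integer $p\ge1$ such that $\mathrm{card}(T^-(z))=p$ for every $z\in T(\mathcal{X})$; (A2) for each $x\in\mathcal{X}$, the Jacobian matrix $\frac{\partial T}{\partial x}(x)$ has full rank $n_x$; (A3) for all $(x_a,x_b)\in\mathcal{X}\times\mathcal{X}$, $T(x_a)=T(x_b)$ if and only if $x_a\sim x_b$ (backward indistinguishability). Let $y:\mathbb{R}_{\ge0}\to\mathbb{R}^{n_y}$ be an output of the system generated by a solution $x_1$ that remains in $\mathcal{X}$ after some $\bar t>0$ (i.e. $y(t)=h(x_1(t))$ and $x_1(t)\in\mathcal{X}$ for all $t\ge\bar t$). Then the following hold. (i) There exist at most $p$ solutions $[\bar t,\infty)\to\mathcal{X}$ to $\dot x=f(x)$ generating $y$ (i.e. whose image under $h$ equals $y$ on $[\bar t,\infty)$). Besides, such solutions cannot converge to each other: for any two distinct such solutions, their difference does not converge to zero as $t\to\infty$. (ii) There are exactly $p$ such solutions provided that one of the following holds: 1) the set $\mathcal{X}$ is forward invariant for $\dot x=f(x)$; 2) there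 exists a neighborhood $\mathcal{U}\subset\mathbb{R}^{n_x}$ of $\mathcal{X}$ such that $\mathcal{I}_{\mathcal{U}}(x_1(t))=\mathcal{I}_{\mathcal{X}}(x_1(t))$ for all $t\ge\bar t$; 3) the following two properties hold: $$\{f(x),-f(x)\}\cap T_{\mathcal{X}}(x)\neq\emptyset\qquad\forall x\in T^-(T(x_1(\bar t))),$$ $$\{-f(x),f(x)\}\cap T_{\partial\mathcal{X}}(x)=\emptyset\qquad\forall x\in\partial\mathcal{X}.$$
   Context: Backward indistinguishability: two points $x_a,x_b\in\mathbb{R}^{n_x}$ satisfy $x_a\sim x_b$ if the maximal backward solutions $\phi_a:(-\sigma_a,0]\to\mathbb{R}^{n_x}$ and $\phi_b:(-\sigma_b,0]\to\mathbb{R}^{n_x}$ of $\dot x=f(x)$ with $\phi_a(0)=x_a$, $\phi_b(0)=x_b$ verify $h(\phi_a(t))=h(\phi_b(t))$ for all $t\in(-\min\{\sigma_a,\sigma_b\},0]$. For a set $S\subseteq\mathbb{R}^{n_x}$ and $x\in\mathbb{R}^{n_x}$, $\mathcal{I}_S(x):=\{x'\in S: x'\sim x\}$. For a set $K\subset\mathbb{R}^{n_x}$ and a point $x$, $T_K(x)$ denotes the contingent cone of $K$ at $x$ (not to be confused with the map $T$): $T_K(x):=\{v\in\mathbb{R}^{n_x}:\liminf_{s\to0^+} d(x+sv,K)/s=0\}$, where $d(\cdot,K)$ is the Euclidean distance to $K$. $\partial\mathcal{X}$ is the boundary of $\mathcal{X}$. *)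

theory Defs
  imports "HOL-Analysis.Analysis"
begin

(* Multi-indices are functions 'n => nat; has_sum is unconditional (here: absolute) convergence. *)
definition real_analytic_at :: "(real^'n \<Rightarrow> 'b::real_normed_vector) \<Rightarrow> real^'n \<Rightarrow> bool" where
  "real_analytic_at f a \<longleftrightarrow>
     (\<exists>(c :: ('n \<Rightarrow> nat) \<Rightarrow> 'b) r. r > 0 \<and>
        (\<forall>x\<in>ball a r.
           ((\<lambda>\<alpha>. (\<Prod>i\<in>UNIV. (x $ i - a $ i) ^ \<alpha> i) *\<^sub>R c \<alpha>) has_sum f x) UNIV))"

definition real_analytic :: "(real^'n \<Rightarrow> 'b::real_normed_vector) \<Rightarrow> bool" where
  "real_analytic f \<longleftrightarrow> (\<forall>a. real_analytic_at f a)"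

(* T is C^1 on S with Jacobian matrix J. On a set S that need not be open this means, as usual,
   that T is the restriction of a C^1 map defined on an open neighbourhood of S, with J the
   restriction of its Jacobian; the lemma below treats open S. *)
definition C1_on_with_jacobian ::
    "(real^'n \<Rightarrow> real^'k) \<Rightarrow> (real^'n \<Rightarrow> real^'n^'k) \<Rightarrow> (real^'n) set \<Rightarrow> bool" where
  "C1_on_with_jacobian T J S \<longleftrightarrow>
     (\<exists>W g G. open W \<and> S \<subseteq> W \<and>
        (\<forall>x\<in>W. (g has_derivative (\<lambda>v. G x *v v)) (at x)) \<and> continuous_on W G \<and>
        (\<forall>x\<in>S. g x = T x \<and> G x = J x))"

lemma C1_on_with_jacobian_open:
  assumes "open S"
  shows "C1_on_with_jacobian T J S \<longleftrightarrow>
    (\<forall>x\<in>S. (T has_derivative (\<lambda>v. J x *v v)) (at x)) \<and> continuous_on S J"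
proof
  assume "C1_on_with_jacobian T J S"
  then obtain W g G where W: "S \<subseteq> W"
    and D: "\<And>x. x \<in> W \<Longrightarrow> (g has_derivative (\<lambda>v. G x *v v)) (at x)"
    and C: "continuous_on W G"
    and eq: "\<And>x. x \<in> S \<Longrightarrow> g x = T x \<and> G x = J x"
    unfolding C1_on_with_jacobian_def by blast
  have "(T has_derivative (\<lambda>v. J x *v v)) (at x)" if "x \<in> S" for x
  proof -
    have "(g has_derivative (\<lambda>v. J x *v v)) (at x)"
      using D[of x] eq[OF that] W that by auto
    then show ?thesis
      by (rule has_derivative_transform_within_open[OF _ assms that]) (simp add: eq)
  qed
  moreover have "continuous_on S J"
    using continuous_on_subset[OF C W] by (rule continuous_on_eq) (simp add: eq)
  ultimately show "(\<forall>x\<in>S. (T has_derivative (\<lambda>v. J x *v v)) (at x)) \<and> continuous_on S J"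
    by blast
next
  assume "(\<forall>x\<in>S. (T has_derivative (\<lambda>v. J x *v v)) (at x)) \<and> continuous_on S J"
  then show "C1_on_with_jacobian T J S"
    unfolding C1_on_with_jacobian_def using assms by blast
qed

definition solves_ode_on :: "('a::real_normed_vector \<Rightarrow> 'a) \<Rightarrow> (real \<Rightarrow> 'a) \<Rightarrow> real set \<Rightarrow> bool" where
  "solves_ode_on f x J \<longleftrightarrow> (\<forall>t\<in>J. (x has_vector_derivative f (x t)) (at t within J))"

(* The half-open interval (-\<sigma>, 0], where \<sigma> may be infinite. *)
definition backward_interval :: "ereal \<Rightarrow> real set" where
  "backward_interval \<sigma> = {t. - \<sigma> < ereal t \<and> t \<le> 0}"

definition backward_solution ::
    "('a::real_normed_vector \<Rightarrow> 'a) \<Rightarrow> 'a \<Rightarrow> ereal \<Rightarrow> (real \<Rightarrow> 'a) \<Rightarrow> bool" where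
  "backward_solution f x \<sigma> \<phi> \<longleftrightarrow>
     0 < \<sigma> \<and> \<phi> 0 = x \<and> solves_ode_on f \<phi> (backward_interval \<sigma>)"

definition maximal_backward_solution ::
    "('a::real_normed_vector \<Rightarrow> 'a) \<Rightarrow> 'a \<Rightarrow> ereal \<Rightarrow> (real \<Rightarrow> 'a) \<Rightarrow> bool" where
  "maximal_backward_solution f x \<sigma> \<phi> \<longleftrightarrow>
     backward_solution f x \<sigma> \<phi> \<and>
     (\<forall>\<sigma>' \<psi>. backward_solution f x \<sigma>' \<psi> \<longrightarrow> \<sigma> \<le> \<sigma>' \<longrightarrow>
        (\<forall>t\<in>backward_interval \<sigma>. \<psi> t = \<phi> t) \<longrightarrow> \<sigma>' = \<sigma>)"

(* Meant for locally Lipschitz f, where the maximal backward solution from a point exists and is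
   unique (up to its irrelevant values outside its interval), so that the universal quantifier
   expresses "the". *)
definition backward_indistinguishable ::
    "('a::real_normed_vector \<Rightarrow> 'a) \<Rightarrow> ('a \<Rightarrow> 'b) \<Rightarrow> 'a \<Rightarrow> 'a \<Rightarrow> bool" where
  "backward_indistinguishable f h x\<^sub>a x\<^sub>b \<longleftrightarrow>
     (\<forall>\<sigma>\<^sub>a \<phi>\<^sub>a \<sigma>\<^sub>b \<phi>\<^sub>b. maximal_backward_solution f x\<^sub>a \<sigma>\<^sub>a \<phi>\<^sub>a \<longrightarrow>
        maximal_backward_solution f x\<^sub>b \<sigma>\<^sub>b \<phi>\<^sub>b \<longrightarrow>
        (\<forall>t\<in>backward_interval (min \<sigma>\<^sub>a \<sigma>\<^sub>b). h (\<phi>\<^sub>a t) = h (\<phi>\<^sub>b t)))"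

definition indist_set ::
    "('a::real_normed_vector \<Rightarrow> 'a) \<Rightarrow> ('a \<Rightarrow> 'b) \<Rightarrow> 'a set \<Rightarrow> 'a \<Rightarrow> 'a set" where
  "indist_set f h S x = {x'\<in>S. backward_indistinguishable f h x' x}"

(* Only meaningful for nonempty K, as infdist x {} = 0; a nonempty compact set in R^n, n >= 1, has
   nonempty boundary. *)
definition contingent_cone :: "'a::real_normed_vector set \<Rightarrow> 'a \<Rightarrow> 'a set" where
  "contingent_cone K x =
     {v. Liminf (at_right 0) (\<lambda>s. ereal (infdist (x + s *\<^sub>R v) K / s)) = 0}"

definition fibre :: "('a \<Rightarrow> 'b) \<Rightarrow> 'a set \<Rightarrow> 'b \<Rightarrow> 'a set" where
  "fibre T X z = {x\<in>X. T x = z}"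

(* Every forward solution starting in X stays in X throughout its interval of existence. *)
definition forward_invariant :: "('a::real_normed_vector \<Rightarrow> 'a) \<Rightarrow> 'a set \<Rightarrow> bool" where
  "forward_invariant f X \<longleftrightarrow>
     (\<forall>\<phi> \<tau>. 0 \<le> \<tau> \<longrightarrow> solves_ode_on f \<phi> {0..\<tau>} \<longrightarrow> \<phi> 0 \<in> X \<longrightarrow> (\<forall>t\<in>{0..\<tau>}. \<phi> t \<in> X))"

(* Solutions [t0, \<infinity>) -> X generating y, as extensional functions on [t0, \<infinity>), so that
   equality of elements is equality on [t0, \<infinity>) and cardinalities are meaningful. *)
definition generating_solutions ::
    "('a::real_normed_vector \<Rightarrow> 'a) \<Rightarrow> ('a \<Rightarrow> 'b) \<Rightarrow> 'a set \<Rightarrow> (real \<Rightarrow> 'b) \<Rightarrow> real \<Rightarrow> (real \<Rightarrow> 'a) set" where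
  "generating_solutions f h X y t0 =
     {x \<in> {t0..} \<rightarrow>\<^sub>E X. solves_ode_on f x {t0..} \<and> (\<forall>t\<ge>t0. h (x t) = y t)}"

end

theory Submission
  imports Defs "HOL-Complex_Analysis.Conformal_Mappings"
begin

text \<open>Solutions of an analytic equation are analytic in time, because Picard iteration for the
  complexified field stays within holomorphic functions. By the identity theorem, two states are
  backward indistinguishable as soon as the outputs agree on a short past interval, and then the
  outputs agree on every common interval of existence. Hence T is constant along pairs of solutions in
  X with the same output, and such a solution is determined by its value at tbar, a point of a fibre
  with p elements. As T is an immersion, distinct points of a fibre are at distance at least some
  fixed \<open>\<delta>\<close>, so distinct solutions cannot converge to each other.

  For (ii) one shows that the solutions through all p points of the fibre stay in X. The last case is
  the delicate one: where a solution meets the boundary coming from the interior, the fibres over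
  nearby points of x1 contain points close to it, and flowing these back into the interior identifies
  them with points of the solution itself.\<close>

section \<open>Complexification of real analytic maps\<close>

text \<open>Analyticity in several variables is reduced to complex analysis in one: the complexified
  field is tested only along holomorphic curves, Cauchy's estimate on complex lines yields its
  Lipschitz constant, and the identity theorem is applied to outputs as functions of complex time.

  Indistinguishability as defined compares outputs up to the shorter of two existence times. For
  three states with different existence times its transitivity is not visible, whereas agreement on
  some short past interval is clearly transitive. Transitivity is what ties a nearby fibre point to
  the solution under study, with x1 as the intermediary.

  The obstacle in the last case is that the cone condition on X is known only on the fibre at tbar.
  At later times the past of the solution inside X takes its place, and transversality puts that
  past into the interior. At tbar there is no such past: if only \<open>- f\<close> is tangent, the
  solution is continued backward from its initial point and compared with x1 before tbar, which
  \<open>tbar > 0\<close> makes possible.\<close>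

definition cvec :: "real^'n \<Rightarrow> complex^'n" where
  "cvec x = (\<chi> i. of_real (x $ i))"

lemma cvec_nth [simp]: "cvec x $ i = of_real (x $ i)"
  by (simp add: cvec_def)

lemma norm_cvec [simp]: "norm (cvec x) = norm x"
  by (simp add: norm_vec_def cvec_def)

text \<open>The third clause stands in for holomorphy in several variables: for a power series it is a
  statement about uniform limits of holomorphic functions of one variable.\<close>

definition bounded_holomorphic :: "(complex^'n \<Rightarrow> complex^'m) \<Rightarrow> real \<Rightarrow> real \<Rightarrow> bool" where
  "bounded_holomorphic F \<rho> M \<longleftrightarrow> 0 < \<rho> \<and>
     (\<forall>z j. norm z \<le> \<rho> \<longrightarrow> norm (F z $ j) \<le> M) \<and>
     (\<forall>S Z. open S \<longrightarrow> (\<forall>i. (\<lambda>t. Z t $ i) holomorphic_on S) \<longrightarrow> (\<forall>t\<in>S. norm (Z t) \<le> \<rho>) \<longrightarrow>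
        (\<forall>j. (\<lambda>t. F (Z t) $ j) holomorphic_on S))"

lemma bounded_holomorphic_mono:
  assumes "bounded_holomorphic F \<rho> M" "0 < \<rho>'" "\<rho>' \<le> \<rho>" "M \<le> M'"
  shows "bounded_holomorphic F \<rho>' M'"
  using assms unfolding bounded_holomorphic_def by (meson order_trans)

lemma bounded_holomorphic_compose:
  assumes "bounded_holomorphic F \<rho> M" "open S" "\<And>i. (\<lambda>t. Z t $ i) holomorphic_on S"
    "\<And>t. t \<in> S \<Longrightarrow> norm (Z t) \<le> \<rho>"
  shows "(\<lambda>t. F (Z t) $ j) holomorphic_on S"
proof -
  have "\<forall>S Z. open S \<longrightarrow> (\<forall>i. (\<lambda>t. Z t $ i) holomorphic_on S) \<longrightarrow> (\<forall>t\<in>S. norm (Z t) \<le> \<rho>) \<longrightarrow>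
        (\<forall>j. (\<lambda>t. F (Z t) $ j) holomorphic_on S)"
    using assms(1) unfolding bounded_holomorphic_def by simp
  from this[rule_format, of S Z j] show ?thesis using assms(2-) by simp
qed

text \<open>Unconditional convergence of a real series is absolute, so the terms are absolutely
  summable at the corner with all coordinates \<open>\<rho>\<close>. These values majorize the same
  power series at every complex point of norm at most \<open>\<rho>\<close>, where the series
  therefore defines F.\<close>

lemma complexification:
  fixes f :: "real^'n \<Rightarrow> real^'m"
  assumes "real_analytic_at f a"
  obtains \<rho> M and F :: "complex^'n \<Rightarrow> complex^'m"
  where "bounded_holomorphic F \<rho> M" "\<And>x. norm x \<le> \<rho> \<Longrightarrow> F (cvec x) = cvec (f (a + x))"
proof -
  obtain c :: "('n \<Rightarrow> nat) \<Rightarrow> real^'m" and r where r: "r > 0" and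
    c: "\<And>x. x \<in> ball a r \<Longrightarrow>
      ((\<lambda>\<alpha>. (\<Prod>i\<in>UNIV. (x $ i - a $ i) ^ \<alpha> i) *\<^sub>R c \<alpha>) has_sum f x) UNIV"
    using assms unfolding real_analytic_at_def by blast
  have cj: "((\<lambda>\<alpha>. (\<Prod>i\<in>UNIV. (x $ i) ^ \<alpha> i) * c \<alpha> $ j) has_sum f (a + x) $ j) UNIV"
    if "norm x < r" for x j
  proof -
    have "a + x \<in> ball a r" using that by (simp add: dist_norm)
    from has_sum_bounded_linear[OF bounded_linear_vec_nth[of j] c[OF this]] show ?thesis
      by (simp add: o_def)
  qed
  \<comment> \<open>With this choice the corner has l1 norm \<open>r / 2\<close>, so it lies inside
    the ball of convergence.\<close>
  define \<rho> where "\<rho> = r / (2 * CARD('n))"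
  have card: "0 < real CARD('n)" by simp
  have \<rho>: "\<rho> > 0" using r by (simp add: \<rho>_def)
  have "norm ((\<chi> i. \<rho>) :: real^'n) \<le> (\<Sum>i\<in>(UNIV::'n set). \<bar>\<rho>\<bar>)"
    using norm_le_l1_cart[of "(\<chi> i. \<rho>) :: real^'n"] by simp
  also have "\<dots> = r / 2" using r by (simp add: \<rho>_def)
  finally have nr: "norm ((\<chi> i. \<rho>) :: real^'n) < r" using r by simp
  have \<rho>r: "\<rho> < r"
  proof -
    have "\<rho> \<le> norm ((\<chi> i. \<rho>) :: real^'n)"
      using component_le_norm_cart[of "(\<chi> i. \<rho>) :: real^'n"] \<rho> by simp
    with nr show ?thesis by simp
  qed
  define m where "m j \<alpha> = (\<Prod>i\<in>(UNIV::'n set). \<rho> ^ \<alpha> i) * \<bar>c \<alpha> $ j\<bar>" for j and \<alpha> :: "'n \<Rightarrow> nat"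
  have m: "m j summable_on UNIV" for j
  proof -
    have "(\<lambda>\<alpha>. (\<Prod>i\<in>UNIV. \<rho> ^ \<alpha> i) * c \<alpha> $ j) summable_on (UNIV :: ('n \<Rightarrow> nat) set)"
      using cj[OF nr, of j] by (auto simp: summable_on_def)
    then have "(\<lambda>\<alpha>. norm ((\<Prod>i\<in>UNIV. \<rho> ^ \<alpha> i) * c \<alpha> $ j)) summable_on (UNIV :: ('n \<Rightarrow> nat) set)"
      by (rule summable_on_iff_abs_summable_on_real[THEN iffD1])
    moreover have "norm ((\<Prod>i\<in>UNIV. \<rho> ^ \<alpha> i) * c \<alpha> $ j) = m j \<alpha>" for \<alpha> :: "'n \<Rightarrow> nat"
      using \<rho> by (simp add: m_def abs_mult abs_prod)
    ultimately show ?thesis by simp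
  qed
  define g where "g j \<alpha> z = (\<Prod>i\<in>UNIV. (z $ i) ^ \<alpha> i) * of_real (c \<alpha> $ j)"
    for j \<alpha> and z :: "complex^'n"
  have g_le: "norm (g j \<alpha> z) \<le> m j \<alpha>" if "norm z \<le> \<rho>" for j \<alpha> z
  proof -
    have "norm (z $ i) \<le> \<rho>" for i
      using that Finite_Cartesian_Product.norm_nth_le[of z i] by simp
    then have "(\<Prod>i\<in>UNIV. norm (z $ i) ^ \<alpha> i) \<le> (\<Prod>i\<in>UNIV. \<rho> ^ \<alpha> i)"
      by (intro prod_mono) (auto intro: power_mono)
    then show ?thesis
      by (simp add: g_def m_def norm_mult norm_power flip: prod_norm)
        (simp add: mult_right_mono norm_power)
  qed
  define F :: "complex^'n \<Rightarrow> complex^'m" where "F z = (\<chi> j. \<Sum>\<^sub>\<infinity>\<alpha>. g j \<alpha> z)" for z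
  \<comment> \<open>Summing over j gives one bound that serves all components.\<close>
  define M where "M = (\<Sum>j\<in>UNIV. infsum (m j) UNIV)"
  have m0: "0 \<le> m j \<alpha>" for j \<alpha> using \<rho> by (simp add: m_def prod_nonneg)
  have "norm (F z $ j) \<le> M" if "norm z \<le> \<rho>" for z j
  proof -
    have s: "(\<lambda>\<alpha>. norm (g j \<alpha> z)) summable_on UNIV"
      by (rule Infinite_Sum.abs_summable_on_comparison_test'[OF m]) (use g_le that in auto)
    have "norm (F z $ j) \<le> (\<Sum>\<^sub>\<infinity>\<alpha>. norm (g j \<alpha> z))"
      unfolding F_def using norm_infsum_bound[of "\<lambda>\<alpha>. g j \<alpha> z" UNIV] s by simp
    also have "\<dots> \<le> infsum (m j) UNIV"
      by (rule infsum_mono[OF s m]) (use g_le that in auto)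
    also have "\<dots> \<le> M"
      unfolding M_def by (rule member_le_sum) (auto intro!: infsum_nonneg m0)
    finally show ?thesis .
  qed
  moreover have "(\<lambda>t. F (Z t) $ j) holomorphic_on S"
    if S: "open S" and hol: "\<And>i. (\<lambda>t. Z t $ i) holomorphic_on S"
      and le: "\<And>t. t \<in> S \<Longrightarrow> norm (Z t) \<le> \<rho>" for S Z j
  proof -
    have "\<exists>\<epsilon>>0. (\<lambda>t. F (Z t) $ j) holomorphic_on ball t0 \<epsilon>" if t0: "t0 \<in> S" for t0
    proof -
      obtain \<epsilon> where \<epsilon>: "\<epsilon> > 0" "cball t0 \<epsilon> \<subseteq> S"
        using S t0 by (meson open_contains_cball)
      \<comment> \<open>The finite partial sums are polynomials in the holomorphic components of Z;
        the M-test makes their limit holomorphic near \<open>t0\<close>.\<close>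
      have u: "uniform_limit (cball t0 \<epsilon>) (\<lambda>A t. \<Sum>\<alpha>\<in>A. g j \<alpha> (Z t)) (\<lambda>t. F (Z t) $ j)
          (finite_subsets_at_top UNIV)"
        unfolding F_def vec_lambda_beta
        by (rule Weierstrass_m_test_general[OF _ m[of j]]) (use g_le le \<epsilon> in auto)
      have h: "(\<lambda>t. \<Sum>\<alpha>\<in>A. g j \<alpha> (Z t)) holomorphic_on S" for A
        unfolding g_def by (intro holomorphic_intros hol)
      have "continuous_on (cball t0 \<epsilon>) (\<lambda>t. \<Sum>\<alpha>\<in>A. g j \<alpha> (Z t)) \<and>
          (\<lambda>t. \<Sum>\<alpha>\<in>A. g j \<alpha> (Z t)) holomorphic_on ball t0 \<epsilon>" for A
        by (intro conjI holomorphic_on_imp_continuous_on holomorphic_on_subset[OF h \<epsilon>(2)]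
            holomorphic_on_subset[OF h order_trans[OF ball_subset_cball \<epsilon>(2)]])
      then have "(\<lambda>t. F (Z t) $ j) holomorphic_on ball t0 \<epsilon>"
        using holomorphic_uniform_limit[OF always_eventually u finite_subsets_at_top_neq_bot,
            of "(\<lambda>t. F (Z t) $ j) holomorphic_on ball t0 \<epsilon>"] by simp
      then show ?thesis using \<epsilon>(1) by (intro exI[of _ \<epsilon>] conjI)
    qed
    note local = this
    show ?thesis
    proof (rule holomorphic_onI)
      fix t0 assume "t0 \<in> S"
      from local[OF this] obtain \<epsilon> where "\<epsilon> > 0" "(\<lambda>t. F (Z t) $ j) holomorphic_on ball t0 \<epsilon>"
        by (elim exE conjE)
      then have "(\<lambda>t. F (Z t) $ j) field_differentiable at t0"
        by (intro holomorphic_on_imp_differentiable_at[of _ "ball t0 \<epsilon>"]) auto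
      then show "(\<lambda>t. F (Z t) $ j) field_differentiable at t0 within S"
        by (rule field_differentiable_at_within)
    qed
  qed
  moreover have "F (cvec x) = cvec (f (a + x))" if "norm x \<le> \<rho>" for x
  proof -
    have "((\<lambda>\<alpha>. of_real ((\<Prod>i\<in>UNIV. (x $ i) ^ \<alpha> i) * c \<alpha> $ j) :: complex)
        has_sum of_real (f (a + x) $ j)) UNIV" for j
      using cj[of x j] that \<rho>r by (subst has_sum_of_real_iff) auto
    then have "((\<lambda>\<alpha>. g j \<alpha> (cvec x)) has_sum cvec (f (a + x)) $ j) UNIV" for j
      by (simp add: g_def)
    then show ?thesis
      by (simp add: F_def vec_eq_iff infsumI del: cvec_nth)
  qed
  ultimately show ?thesis
    by (intro that[of F \<rho> M]) (simp_all add: bounded_holomorphic_def \<rho>)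
qed

lemma norm_vector_scalar_mult_complex: "norm (u *s v) = norm u * norm (v :: complex^'n)"
  by (simp add: norm_vec_def norm_mult L2_set_right_distrib vector_scalar_mult_def)

text \<open>On the complex line through z and w, F becomes a function of one variable, whose
  derivative on the segment from z to w is controlled by Cauchy's estimate.\<close>

lemma bounded_holomorphic_lipschitz:
  fixes F :: "complex^'n \<Rightarrow> complex^'m"
  assumes F: "bounded_holomorphic F \<rho> M" and z: "norm z \<le> \<rho> / 4" and w: "norm w \<le> \<rho> / 4"
  shows "norm (F z $ j - F w $ j) \<le> 4 * M / \<rho> * norm (z - w)"
proof (cases "z = w")
  case True
  then show ?thesis by simp
next
  case False
  define d where "d = norm (w - z)"
  have d: "d > 0" using False by (simp add: d_def)
  have \<rho>: "\<rho> > 0" using F by (simp add: bounded_holomorphic_def)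
  have d2: "d \<le> \<rho> / 2" using norm_triangle_ineq4[of w z] z w by (simp add: d_def)
  \<comment> \<open>The radius with \<open>\<rho> / 4 + R * d = \<rho>\<close>: the largest for
    which the triangle inequality keeps the line within norm \<open>\<rho>\<close>.\<close>
  define R where "R = 3 * \<rho> / (4 * d)"
  have R: "R \<ge> 3 / 2" using d d2 by (simp add: R_def field_simps)
  define \<phi> where "\<phi> u = F (z + u *s (w - z)) $ j" for u
  have le: "norm (z + u *s (w - z)) \<le> \<rho>" if "u \<in> ball 0 R" for u
  proof -
    have "norm (u *s (w - z)) = norm u * d"
      unfolding d_def by (rule norm_vector_scalar_mult_complex)
    also have "\<dots> \<le> R * d" using that d by (intro mult_right_mono) auto
    also have "\<dots> = 3 * \<rho> / 4" using d by (simp add: R_def)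
    finally show ?thesis using norm_triangle_ineq[of z "u *s (w - z)"] z by simp
  qed
  have hol: "\<phi> holomorphic_on ball 0 R"
  proof -
    have "(\<lambda>u. (z + u *s (w - z)) $ i) holomorphic_on ball 0 R" for i
      by (simp add: vector_scalar_mult_def) (intro holomorphic_intros)
    from bounded_holomorphic_compose[OF F open_ball this le] show ?thesis
      unfolding \<phi>_def .
  qed
  have bnd: "norm (\<phi> u) \<le> M" if "u \<in> ball 0 R" for u
    using le[OF that] F unfolding bounded_holomorphic_def \<phi>_def by blast
  have M: "M \<ge> 0" using order_trans[OF norm_ge_zero bnd[of 0]] R by simp
  have der: "norm (deriv \<phi> u) \<le> M / (R - 1)" if "u \<in> closed_segment 0 1" for u
  proof -
    have l: "norm u \<le> 1" using that by (auto simp: in_segment)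
    \<comment> \<open>The radius stays strictly below \<open>R - 1\<close> so that the closed disc
      around u lies in the open ball of radius R; letting s tend to \<open>R - 1\<close> then gives
      the bound \<open>der\<close>.\<close>
    have *: "norm (deriv \<phi> u) \<le> M / s" if s: "0 < s" "s < R - 1" for s
    proof -
      have sub: "cball u s \<subseteq> ball 0 R"
      proof
        fix v assume "v \<in> cball u s"
        then show "v \<in> ball 0 R"
          using l s norm_triangle_sub[of v u] by (simp add: dist_norm norm_minus_commute)
      qed
      have "norm ((deriv ^^ 1) \<phi> u) \<le> fact 1 * M / s ^ 1"
      proof (rule Cauchy_inequality)
        show "\<phi> holomorphic_on ball u s" using hol sub by (meson ball_subset_cball holomorphic_on_subset subset_trans)
        show "continuous_on (cball u s) \<phi>" using hol sub by (meson holomorphic_on_imp_continuous_on continuous_on_subset)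
        show "norm (\<phi> x) \<le> M" if "norm (u - x) = s" for x
          using sub that by (intro bnd) (auto simp: dist_norm)
      qed (use s in auto)
      then show ?thesis by simp
    qed
    show ?thesis
    proof (rule tendsto_lowerbound)
      show "((\<lambda>s. M / s) \<longlongrightarrow> M / (R - 1)) (at_left (R - 1))"
        using R by (intro tendsto_intros) auto
      show "\<forall>\<^sub>F s in at_left (R - 1). norm (deriv \<phi> u) \<le> M / s"
        using R * unfolding eventually_at_left_field by (intro exI[of _ 0]) auto
    qed simp
  qed
  have "norm (\<phi> 0 - \<phi> 1) \<le> M / (R - 1) * norm (0 - 1 :: complex)"
  proof (rule field_differentiable_bound[of "closed_segment 0 1" \<phi> "deriv \<phi>"])
    fix u :: complex assume l: "u \<in> closed_segment 0 1"
    then have "u \<in> ball 0 R" using R by (auto simp: in_segment)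
    then show "(\<phi> has_field_derivative deriv \<phi> u) (at u within closed_segment 0 1)"
      using hol by (meson holomorphic_derivI open_ball has_field_derivative_at_within)
  qed (use der in auto)
  \<comment> \<open>\<open>R - 1 \<ge> R / 3\<close> because \<open>R \<ge> 3 / 2\<close>; this is
    the origin of the factor 4 in the Lipschitz constant.\<close>
  also have "\<dots> \<le> M / (R / 3)"
    using R M by (intro order_trans[OF eq_refl divide_left_mono]) auto
  also have "\<dots> = 4 * M / \<rho> * norm (z - w)"
    using d \<rho> by (simp add: R_def d_def norm_minus_commute field_simps)
  finally show ?thesis by (simp add: \<phi>_def)
qed

section \<open>Local solutions by holomorphic Picard iteration\<close>

lemma norm_le_sum_nth: "norm x \<le> (\<Sum>i\<in>UNIV. norm (x $ i))"
  by (simp add: norm_vec_def L2_set_le_sum)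

text \<open>W is x0 plus the integral of \<open>F (Z t)\<close> from 0, taken componentwise as a
  primitive on the disc. Of the allowed norm \<open>\<rho> / 4\<close>, one half is spent on x0 and
  the other on the increment. As F maps real points to real points, the imaginary parts of W are
  constant along the real axis.\<close>

lemma picard_step:
  fixes F :: "complex^'n \<Rightarrow> complex^'n" and \<epsilon> :: real
  assumes F: "bounded_holomorphic F \<rho> M"
    and real: "\<And>x. norm x \<le> \<rho> \<Longrightarrow> \<exists>v. F (cvec x) = cvec v"
    and \<epsilon>: "\<epsilon> > 0" "CARD('n) * (M * \<epsilon>) \<le> \<rho> / 8"
    and x0: "norm x0 \<le> \<rho> / 8"
    and Z: "\<And>t. t \<in> ball 0 \<epsilon> \<Longrightarrow> norm (Z t) \<le> \<rho> / 4" "\<And>i. (\<lambda>t. Z t $ i) holomorphic_on ball 0 \<epsilon>"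
      "\<And>s i. \<bar>s\<bar> < \<epsilon> \<Longrightarrow> Im (Z (of_real s) $ i) = 0"
  obtains W where "W 0 = cvec x0" "\<And>t. t \<in> ball 0 \<epsilon> \<Longrightarrow> norm (W t) \<le> \<rho> / 4"
    "\<And>s i. \<bar>s\<bar> < \<epsilon> \<Longrightarrow> Im (W (of_real s) $ i) = 0"
    "\<And>t i. t \<in> ball 0 \<epsilon> \<Longrightarrow> ((\<lambda>t. W t $ i) has_field_derivative F (Z t) $ i) (at t)"
proof -
  have \<rho>: "\<rho> > 0" using F by (simp add: bounded_holomorphic_def)
  have bnd: "norm (F z $ j) \<le> M" if "norm z \<le> \<rho>" for z j
    using F that by (simp add: bounded_holomorphic_def)
  have M: "M \<ge> 0" using order_trans[OF norm_ge_zero bnd[of 0]] \<rho> by simp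
  have Z\<rho>: "norm (Z t) \<le> \<rho>" if "t \<in> ball 0 \<epsilon>" for t
    using Z(1)[OF that] \<rho> by simp
  have "\<exists>g. \<forall>t\<in>ball 0 \<epsilon>. (g has_field_derivative F (Z t) $ i) (at t)" for i
  proof -
    have "(\<lambda>t. F (Z t) $ i) holomorphic_on ball 0 \<epsilon>"
      by (rule bounded_holomorphic_compose[OF F open_ball Z(2) Z\<rho>])
    from holomorphic_convex_primitive'[OF convex_ball open_ball this]
    obtain g where "\<And>t. t \<in> ball 0 \<epsilon> \<Longrightarrow> (g has_field_derivative F (Z t) $ i) (at t within ball 0 \<epsilon>)"
      by metis
    then show ?thesis by (metis at_within_open open_ball)
  qed
  then obtain g where
    g: "\<And>i t. t \<in> ball 0 \<epsilon> \<Longrightarrow> (g i has_field_derivative F (Z t) $ i) (at t)"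
    by metis
  define W where "W t = (\<chi> i. g i t - g i 0 + of_real (x0 $ i))" for t
  have der: "((\<lambda>t. W t $ i) has_field_derivative F (Z t) $ i) (at t)" if "t \<in> ball 0 \<epsilon>" for t i
    unfolding W_def by (auto intro!: derivative_eq_intros g[OF that])
  have W0: "W 0 = cvec x0" by (simp add: W_def vec_eq_iff)
  have "norm (W t) \<le> \<rho> / 4" if t: "t \<in> ball 0 \<epsilon>" for t
  proof -
    have "norm (W t $ i - W 0 $ i) \<le> M * norm (t - 0)" for i
      by (rule field_differentiable_bound[OF convex_ball, of 0 \<epsilon> _ "\<lambda>t. F (Z t) $ i"])
        (use t \<epsilon> der bnd Z\<rho> in \<open>auto intro: has_field_derivative_at_within\<close>)
    moreover have "M * norm (t - 0) \<le> M * \<epsilon>" using t M by (intro mult_left_mono) auto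
    ultimately have *: "norm ((W t - W 0) $ i) \<le> M * \<epsilon>" for i by (smt (verit) vector_minus_component)
    have "norm (W t - W 0) \<le> (\<Sum>i\<in>UNIV. norm ((W t - W 0) $ i))" by (rule norm_le_sum_nth)
    also have "\<dots> \<le> (\<Sum>i\<in>(UNIV::'n set). M * \<epsilon>)" by (intro sum_mono *)
    also have "\<dots> \<le> \<rho> / 8" using \<epsilon> by simp
    finally show ?thesis using norm_triangle_sub[of "W t" "W 0"] x0 by (simp add: W0)
  qed
  moreover have "Im (W (of_real s) $ i) = 0" if s: "\<bar>s\<bar> < \<epsilon>" for s i
  proof -
    have "((\<lambda>s. Im (W (of_real s) $ i)) has_vector_derivative 0) (at s within {-\<epsilon><..<\<epsilon>})"
      if "s \<in> {-\<epsilon><..<\<epsilon>}" for s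
    proof -
      have s: "of_real s \<in> ball (0::complex) \<epsilon>" using that by auto
      have "Z (of_real s) = cvec (\<chi> i. Re (Z (of_real s) $ i))"
        using that by (auto simp: vec_eq_iff complex_eq_iff Z(3))
      then obtain v where "F (Z (of_real s)) = cvec v"
        using real[of "\<chi> i. Re (Z (of_real s) $ i)"] Z\<rho>[OF s] norm_cvec by metis
      then have "Im (F (Z (of_real s)) $ i) = 0" by simp
      moreover have "((\<lambda>s. W (of_real s) $ i) has_vector_derivative F (Z (of_real s)) $ i) (at s)"
        by (rule has_vector_derivative_real_field[OF der[OF s]])
      from bounded_linear.has_vector_derivative[OF bounded_linear_Im this]
      have "((\<lambda>s. Im (W (of_real s) $ i)) has_vector_derivative Im (F (Z (of_real s)) $ i)) (at s)" .
      ultimately show ?thesis by (auto intro: has_vector_derivative_at_within)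
    qed
    then obtain c where c: "\<And>s. s \<in> {-\<epsilon><..<\<epsilon>} \<Longrightarrow> Im (W (of_real s) $ i) = c"
      using has_vector_derivative_zero_constant[of "{-\<epsilon><..<\<epsilon>}" "\<lambda>s. Im (W (of_real s) $ i)"]
      by auto
    have "Im (W (of_real 0) $ i) = 0" by (simp add: W0)
    moreover have "0 \<in> {-\<epsilon><..<\<epsilon>}" "s \<in> {-\<epsilon><..<\<epsilon>}" using s \<epsilon>(1) by auto
    ultimately show ?thesis using c by metis
  qed
  ultimately show ?thesis using W0 der that by blast
qed

text \<open>The contraction estimates depend on F alone, so a single \<open>\<epsilon>\<close>
  serves all initial values near 0. This uniformity is what later turns individual solutions into a
  local flow.\<close>

lemma complex_ode_local_solution:
  fixes F :: "complex^'n \<Rightarrow> complex^'n"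
  assumes F: "bounded_holomorphic F \<rho> M"
    and real: "\<And>x. norm x \<le> \<rho> \<Longrightarrow> \<exists>v. F (cvec x) = cvec v"
  obtains \<epsilon> where "\<epsilon> > 0" "\<forall>x0. norm x0 \<le> \<rho> / 8 \<longrightarrow> (\<exists>Z. Z 0 = cvec x0 \<and>
      (\<forall>t\<in>ball 0 \<epsilon>. norm (Z t) \<le> \<rho> / 4 \<and>
        (\<forall>i. ((\<lambda>t. Z t $ i) has_field_derivative F (Z t) $ i) (at t))) \<and>
      (\<forall>s i. \<bar>s\<bar> < \<epsilon> \<longrightarrow> Im (Z (of_real s) $ i) = 0))"
proof -
  have \<rho>: "\<rho> > 0" using F by (simp add: bounded_holomorphic_def)
  have bnd: "norm (F z $ j) \<le> M" if "norm z \<le> \<rho>" for z j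
    using F that by (simp add: bounded_holomorphic_def)
  have M: "M \<ge> 0" using order_trans[OF norm_ge_zero bnd[of 0]] \<rho> by simp
  define N where "N = real CARD('n)"
  have N: "N > 0" by (simp add: N_def)
  \<comment> \<open>Gives \<open>N * (M * \<epsilon>) \<le> \<rho> / 8\<close>, as
    \<open>picard_step\<close> requires, and, since the Lipschitz constant is
    \<open>4 * M / \<rho>\<close>, at once the contraction factor 1 / 2. The summand 1 keeps the
    denominator positive when M is 0.\<close>
  define \<epsilon> where "\<epsilon> = \<rho> / (8 * N * (M + 1))"
  have \<epsilon>: "\<epsilon> > 0" using \<rho> N M by (simp add: \<epsilon>_def)
  have "N \<noteq> 0" "M + 1 \<noteq> 0" using N M by auto
  then have "N * ((M + 1) * \<epsilon>) = \<rho> / 8" unfolding \<epsilon>_def by (simp del: distrib_left_numeral)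
  moreover have "N * (M * \<epsilon>) \<le> N * ((M + 1) * \<epsilon>)" using N M \<epsilon> by (intro mult_left_mono mult_right_mono) auto
  ultimately have NM: "N * (M * \<epsilon>) \<le> \<rho> / 8" by simp
  define L where "L = 4 * M / \<rho>"
  have L0: "L \<ge> 0" using M \<rho> by (simp add: L_def)
  have NL: "N * (L * \<epsilon>) \<le> 1 / 2"
  proof -
    have "N * (L * \<epsilon>) = 4 / \<rho> * (N * (M * \<epsilon>))" by (simp add: L_def)
    also have "\<dots> \<le> 4 / \<rho> * (\<rho> / 8)" using NM \<rho> by (intro mult_left_mono) auto
    finally show ?thesis using \<rho> by simp
  qed
  have lip: "norm (F z $ j - F w $ j) \<le> L * norm (z - w)" if "norm z \<le> \<rho> / 4" "norm w \<le> \<rho> / 4" for z w j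
    unfolding L_def by (rule bounded_holomorphic_lipschitz[OF F that])
  show ?thesis
  proof (rule that[OF \<epsilon>], intro allI impI)
    fix x0 :: "real^'n" assume x0: "norm x0 \<le> \<rho> / 8"
    define P where "P Z \<longleftrightarrow> Z 0 = cvec x0 \<and> (\<forall>t\<in>ball 0 \<epsilon>. norm (Z t) \<le> \<rho> / 4) \<and>
      (\<forall>i. (\<lambda>t. Z t $ i) holomorphic_on ball 0 \<epsilon>) \<and> (\<forall>s i. \<bar>s\<bar> < \<epsilon> \<longrightarrow> Im (Z (of_real s) $ i) = 0)" for Z
    define Q where "Q Z W \<longleftrightarrow> (\<forall>t\<in>ball 0 \<epsilon>. \<forall>i. ((\<lambda>t. W t $ i) has_field_derivative F (Z t) $ i) (at t))" for Z W
    have base: "\<exists>Z. P Z"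
      using x0 \<rho> by (intro exI[of _ "\<lambda>_. cvec x0"]) (auto simp: P_def)
    have step: "\<exists>W. P W \<and> Q Z W" if "P Z" for Z
    proof -
      have p: "\<And>t. t \<in> ball 0 \<epsilon> \<Longrightarrow> norm (Z t) \<le> \<rho> / 4" "\<And>i. (\<lambda>t. Z t $ i) holomorphic_on ball 0 \<epsilon>"
        "\<And>s i. \<bar>s\<bar> < \<epsilon> \<Longrightarrow> Im (Z (of_real s) $ i) = 0"
        using that unfolding P_def by simp_all
      obtain W where W: "W 0 = cvec x0" "\<And>t. t \<in> ball 0 \<epsilon> \<Longrightarrow> norm (W t) \<le> \<rho> / 4"
        "\<And>s i. \<bar>s\<bar> < \<epsilon> \<Longrightarrow> Im (W (of_real s) $ i) = 0"
        "\<And>t i. t \<in> ball 0 \<epsilon> \<Longrightarrow> ((\<lambda>t. W t $ i) has_field_derivative F (Z t) $ i) (at t)"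
        using picard_step[OF F real \<epsilon> NM[unfolded N_def] x0 p] by metis
      have "(\<lambda>t. W t $ i) holomorphic_on ball 0 \<epsilon>" for i
        using W(4) by (intro holomorphic_onI) (meson field_differentiable_at_within field_differentiable_def)
      with W show ?thesis unfolding P_def Q_def by auto
    qed
    \<comment> \<open>A Picard image is only known to exist, so the sequence comes from dependent
      choice, with Q linking each iterate to its predecessor.\<close>
    from dependent_nat_choice[of "\<lambda>_. P" "\<lambda>_. Q", OF base step]
    obtain Z where ZP: "\<And>n. P (Z n)" and ZQ: "\<And>n. Q (Z n) (Z (Suc n))" by blast
    have Z0: "Z n 0 = cvec x0" and Z1: "t \<in> ball 0 \<epsilon> \<Longrightarrow> norm (Z n t) \<le> \<rho> / 4"
      and Z2: "\<bar>s\<bar> < \<epsilon> \<Longrightarrow> Im (Z n (of_real s) $ i) = 0" for n t s i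
      using ZP[of n] unfolding P_def by simp_all
    have der: "((\<lambda>t. Z (Suc n) t $ i) has_field_derivative F (Z n t) $ i) (at t)" if "t \<in> ball 0 \<epsilon>" for n t i
      using ZQ[of n] that unfolding Q_def by simp
    \<comment> \<open>Two points of norm at most \<open>\<rho> / 4\<close> differ by at most
      \<open>\<rho> / 2\<close>. Each further step integrates L times the previous bound over a time
      below \<open>\<epsilon>\<close> and sums N components, a factor of at most 1 / 2 by
      \<open>NL\<close>.\<close>
    have diff: "norm (Z (Suc n) t - Z n t) \<le> \<rho> / 2 * (1 / 2) ^ n" if "t \<in> ball 0 \<epsilon>" for n t
      using that
    proof (induction n arbitrary: t)
      case 0
      then show ?case
        using norm_triangle_ineq4[of "Z 1 t" "Z 0 t"] Z1[of t 0] Z1[of t 1] by simp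
    next
      case (Suc n)
      define K where "K = \<rho> / 2 * (1 / 2) ^ n"
      have "norm ((Z (Suc (Suc n)) t $ i - Z (Suc n) t $ i) - (Z (Suc (Suc n)) 0 $ i - Z (Suc n) 0 $ i))
          \<le> L * K * norm (t - 0)" for i
      proof (rule field_differentiable_bound[OF convex_ball, of 0 \<epsilon> _ "\<lambda>t. F (Z (Suc n) t) $ i - F (Z n t) $ i"])
        fix u :: complex assume u: "u \<in> ball 0 \<epsilon>"
        show "((\<lambda>t. Z (Suc (Suc n)) t $ i - Z (Suc n) t $ i) has_field_derivative
            F (Z (Suc n) u) $ i - F (Z n u) $ i) (at u within ball 0 \<epsilon>)"
          by (intro has_field_derivative_at_within[OF DERIV_diff] der u)
        have "norm (F (Z (Suc n) u) $ i - F (Z n u) $ i) \<le> L * norm (Z (Suc n) u - Z n u)"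
          by (intro lip Z1 u)
        also have "\<dots> \<le> L * K" using Suc.IH[OF u] L0 by (intro mult_left_mono) (auto simp: K_def)
        finally show "norm (F (Z (Suc n) u) $ i - F (Z n u) $ i) \<le> L * K" .
      qed (use Suc.prems \<epsilon> in auto)
      then have "norm ((Z (Suc (Suc n)) t - Z (Suc n) t) $ i) \<le> L * K * norm t" for i
        by (simp add: Z0)
      moreover have "L * K * norm t \<le> L * K * \<epsilon>"
        using Suc.prems L0 \<rho> by (intro mult_left_mono) (auto simp: K_def)
      ultimately have *: "norm ((Z (Suc (Suc n)) t - Z (Suc n) t) $ i) \<le> L * K * \<epsilon>" for i
        by (meson order_trans)
      have "norm (Z (Suc (Suc n)) t - Z (Suc n) t) \<le>
          (\<Sum>i\<in>UNIV. norm ((Z (Suc (Suc n)) t - Z (Suc n) t) $ i))" by (rule norm_le_sum_nth)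
      also have "\<dots> \<le> (\<Sum>i\<in>(UNIV::'n set). L * K * \<epsilon>)" by (intro sum_mono *)
      also have "\<dots> = N * (L * \<epsilon>) * K" by (simp add: N_def)
      also have "\<dots> \<le> 1 / 2 * K" using NL \<rho> by (intro mult_right_mono) (auto simp: K_def)
      finally show ?case by (simp add: K_def)
    qed
    \<comment> \<open>The limit of the iterates, written as a telescoping series so that the M-test
      applies on the whole disc.\<close>
    define S where "S t = (\<chi> i. (\<Sum>n. (Z (Suc n) t - Z n t) $ i) + Z 0 t $ i)" for t
    have ulim: "uniform_limit (ball 0 \<epsilon>) (\<lambda>n t. Z n t $ i) (\<lambda>t. S t $ i) sequentially" for i
    proof -
      have "uniform_limit (ball 0 \<epsilon>) (\<lambda>n t. \<Sum>k<n. (Z (Suc k) t - Z k t) $ i)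
          (\<lambda>t. \<Sum>k. (Z (Suc k) t - Z k t) $ i) sequentially"
      proof (rule Weierstrass_m_test)
        show "norm ((Z (Suc n) t - Z n t) $ i) \<le> \<rho> / 2 * (1 / 2) ^ n" if "t \<in> ball 0 \<epsilon>" for n t
          using diff[OF that] Finite_Cartesian_Product.norm_nth_le order_trans by blast
        show "summable (\<lambda>n. \<rho> / 2 * (1 / 2) ^ n)" by (intro summable_mult summable_geometric) simp
      qed
      from uniform_limit_add[OF this uniform_limit_const[where c = "\<lambda>t. Z 0 t $ i"]]
      have "uniform_limit (ball 0 \<epsilon>) (\<lambda>n t. (\<Sum>k<n. (Z (Suc k) t - Z k t) $ i) + Z 0 t $ i)
          (\<lambda>t. S t $ i) sequentially" by (simp add: S_def)
      moreover have "(\<Sum>k<n. (Z (Suc k) t - Z k t) $ i) = Z n t $ i - Z 0 t $ i" for n t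
        using sum_lessThan_telescope[of "\<lambda>k. Z k t $ i" n] by simp
      ultimately show ?thesis by simp
    qed
    have lim: "(\<lambda>n. Z n t) \<longlonglongrightarrow> S t" if "t \<in> ball 0 \<epsilon>" for t
      by (intro vec_tendstoI tendsto_uniform_limitI[OF ulim that])
    have S1: "norm (S t) \<le> \<rho> / 4" if "t \<in> ball 0 \<epsilon>" for t
      by (rule Lim_norm_ubound[OF _ lim[OF that]]) (simp_all add: Z1[OF that] del: le_divide_eq_numeral1)
    \<comment> \<open>For holomorphic functions uniform convergence carries over to derivatives. The
      limit of the derivatives \<open>F (Z n t)\<close> is then identified with
      \<open>F (S t)\<close> by the Lipschitz bound.\<close>
    have "\<exists>g'. \<forall>t\<in>ball 0 \<epsilon>. ((\<lambda>t. S t $ i) has_field_derivative g' t) (at t) \<and>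
        ((\<lambda>n. F (Z n t) $ i) \<longlonglongrightarrow> g' t)" for i
    proof (rule has_complex_derivative_uniform_sequence[OF open_ball der])
      fix t :: complex assume "t \<in> ball 0 \<epsilon>"
      then obtain d where d: "d > 0" "cball t d \<subseteq> ball 0 \<epsilon>"
        using open_contains_cball_eq[OF open_ball] by blast
      have "uniform_limit (cball t d) (\<lambda>n t. Z (Suc n) t $ i) (\<lambda>t. S t $ i) sequentially"
        using uniform_limit_on_subset[OF ulim d(2)] filterlim_Suc
        by (rule filterlim_compose)
      with d show "\<exists>d>0. cball t d \<subseteq> ball 0 \<epsilon> \<and>
          uniform_limit (cball t d) (\<lambda>n t. Z (Suc n) t $ i) (\<lambda>t. S t $ i) sequentially" by auto
    qed
    moreover have "(\<lambda>n. F (Z n t) $ i) \<longlonglongrightarrow> F (S t) $ i" if t: "t \<in> ball 0 \<epsilon>" for t i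
    proof (rule Lim_null_comparison[THEN LIM_zero_cancel])
      show "\<forall>\<^sub>F n in sequentially. norm (F (Z n t) $ i - F (S t) $ i) \<le> L * norm (Z n t - S t)"
        using lip[OF Z1[OF t] S1[OF t]] by simp
      show "(\<lambda>n. L * norm (Z n t - S t)) \<longlonglongrightarrow> 0"
        using tendsto_mult_right_zero[OF tendsto_norm_zero[OF LIM_zero[OF lim[OF t]]]] by simp
    qed
    ultimately have S2: "((\<lambda>t. S t $ i) has_field_derivative F (S t) $ i) (at t)" if "t \<in> ball 0 \<epsilon>" for t i
      using that by (metis LIMSEQ_unique)
    have S3: "Im (S (of_real s) $ i) = 0" if "\<bar>s\<bar> < \<epsilon>" for s i
    proof -
      have "of_real s \<in> ball (0::complex) \<epsilon>" using that by simp
      from tendsto_Im[OF tendsto_vec_nth[OF lim[OF this], of i]] Z2[OF that]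
      show ?thesis by (simp add: LIMSEQ_const_iff)
    qed
    have S0: "S 0 = cvec x0"
      using lim[of 0] \<epsilon> by (simp add: Z0 LIMSEQ_const_iff)
    show "\<exists>Z. Z 0 = cvec x0 \<and> (\<forall>t\<in>ball 0 \<epsilon>. norm (Z t) \<le> \<rho> / 4 \<and>
        (\<forall>i. ((\<lambda>t. Z t $ i) has_field_derivative F (Z t) $ i) (at t))) \<and>
      (\<forall>s i. \<bar>s\<bar> < \<epsilon> \<longrightarrow> Im (Z (of_real s) $ i) = 0)"
      using S0 S1 S2 S3 by (intro exI[of _ S]) auto
  qed
qed

text \<open>The complex solutions started at \<open>b - a\<close>, restricted to real times and
  translated back. Besides a time \<open>\<epsilon>\<close> common to all b, the holomorphic
  extension H(Z) of each output is kept, for the identity theorem.\<close>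

lemma analytic_local_flow:
  fixes f :: "real^'n \<Rightarrow> real^'n" and h :: "real^'n \<Rightarrow> real^'m"
  assumes "real_analytic_at f a" "real_analytic_at h a"
  obtains \<delta> \<epsilon> r L \<Phi> where "\<delta> > 0" "\<epsilon> > 0" "r > 0"
    "\<forall>x\<in>cball a r. \<forall>y\<in>cball a r. norm (f x - f y) \<le> L * norm (x - y)"
    "\<forall>b\<in>ball a \<delta>. \<Phi> b 0 = b"
    "\<forall>b\<in>ball a \<delta>. \<forall>t. \<bar>t\<bar> < \<epsilon> \<longrightarrow> \<Phi> b t \<in> cball a r"
    "\<forall>b\<in>ball a \<delta>. \<forall>t. \<bar>t\<bar> < \<epsilon> \<longrightarrow> (\<Phi> b has_vector_derivative f (\<Phi> b t)) (at t)"
    "\<forall>b\<in>ball a \<delta>. \<forall>j. \<exists>G. G holomorphic_on ball 0 \<epsilon> \<and>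
        (\<forall>t. \<bar>t\<bar> < \<epsilon> \<longrightarrow> G (of_real t) = of_real (h (\<Phi> b t) $ j))"
proof -
  obtain \<rho>1 M1 F where F1: "bounded_holomorphic F \<rho>1 M1"
    and F2: "\<And>x. norm x \<le> \<rho>1 \<Longrightarrow> F (cvec x) = cvec (f (a + x))"
    using complexification[OF assms(1)] by metis
  obtain \<rho>2 M2 H where H1: "bounded_holomorphic H \<rho>2 M2"
    and H2: "\<And>x. norm x \<le> \<rho>2 \<Longrightarrow> H (cvec x) = cvec (h (a + x))"
    using complexification[OF assms(2)] by metis
  define \<rho> where "\<rho> = min \<rho>1 \<rho>2"
  have \<rho>: "\<rho> > 0" using F1 H1 by (simp add: \<rho>_def bounded_holomorphic_def)
  have F: "bounded_holomorphic F \<rho> M1" and H: "bounded_holomorphic H \<rho> M2"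
    using bounded_holomorphic_mono[OF F1 \<rho>] bounded_holomorphic_mono[OF H1 \<rho>] by (auto simp: \<rho>_def)
  have real: "\<exists>v. F (cvec x) = cvec v" if "norm x \<le> \<rho>" for x
    using F2[of x] that by (auto simp: \<rho>_def)
  obtain \<epsilon> where \<epsilon>: "\<epsilon> > 0" and sol: "\<forall>x0. norm x0 \<le> \<rho> / 8 \<longrightarrow> (\<exists>Z. Z 0 = cvec x0 \<and>
      (\<forall>t\<in>ball 0 \<epsilon>. norm (Z t) \<le> \<rho> / 4 \<and>
        (\<forall>i. ((\<lambda>t. Z t $ i) has_field_derivative F (Z t) $ i) (at t))) \<and>
      (\<forall>s i. \<bar>s\<bar> < \<epsilon> \<longrightarrow> Im (Z (of_real s) $ i) = 0))"
    by (rule complex_ode_local_solution[OF F real])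
  have "\<exists>Z. Z 0 = cvec (b - a) \<and>
      (\<forall>t\<in>ball 0 \<epsilon>. norm (Z t) \<le> \<rho> / 4 \<and>
        (\<forall>i. ((\<lambda>t. Z t $ i) has_field_derivative F (Z t) $ i) (at t))) \<and>
      (\<forall>s i. \<bar>s\<bar> < \<epsilon> \<longrightarrow> Im (Z (of_real s) $ i) = 0)" if "b \<in> ball a (\<rho> / 8)" for b
    by (rule sol[rule_format]) (use that in \<open>simp add: dist_norm norm_minus_commute\<close>)
  then obtain Z where Z: "\<And>b. b \<in> ball a (\<rho> / 8) \<Longrightarrow> Z b 0 = cvec (b - a) \<and>
      (\<forall>t\<in>ball 0 \<epsilon>. norm (Z b t) \<le> \<rho> / 4 \<and>
        (\<forall>i. ((\<lambda>t. Z b t $ i) has_field_derivative F (Z b t) $ i) (at t))) \<and>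
      (\<forall>s i. \<bar>s\<bar> < \<epsilon> \<longrightarrow> Im (Z b (of_real s) $ i) = 0)" by metis
  have Z0: "Z b 0 = cvec (b - a)" and Z1: "t \<in> ball 0 \<epsilon> \<Longrightarrow> norm (Z b t) \<le> \<rho> / 4"
    and Z2: "t \<in> ball 0 \<epsilon> \<Longrightarrow> ((\<lambda>t. Z b t $ i) has_field_derivative F (Z b t) $ i) (at t)"
    and Z3: "\<bar>s\<bar> < \<epsilon> \<Longrightarrow> Im (Z b (of_real s) $ i) = 0"
    if "b \<in> ball a (\<rho> / 8)" for b t s i
    using Z[OF that] by simp_all
  \<comment> \<open>Nothing is lost by taking real parts: at real times the imaginary parts of Z
    vanish, which is \<open>cv\<close>.\<close>
  define \<Phi> where "\<Phi> b t = a + (\<chi> i. Re (Z b (of_real t) $ i))" for b and t :: real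
  have cv: "Z b (of_real t) = cvec (\<Phi> b t - a)" if "b \<in> ball a (\<rho> / 8)" "\<bar>t\<bar> < \<epsilon>" for b t
    using Z3[OF that] by (simp add: \<Phi>_def vec_eq_iff complex_eq_iff)
  have nrm: "norm (\<Phi> b t - a) \<le> \<rho> / 4" if "b \<in> ball a (\<rho> / 8)" "\<bar>t\<bar> < \<epsilon>" for b t
    using Z1[OF that(1), of "of_real t"] that(2) cv[OF that] by simp
  have fdiff: "norm (f x - f y) \<le> CARD('n) * (4 * M1 / \<rho>) * norm (x - y)"
    if "x \<in> cball a (\<rho> / 4)" "y \<in> cball a (\<rho> / 4)" for x y
  proof -
    have n: "norm (x - a) \<le> \<rho> / 4" "norm (y - a) \<le> \<rho> / 4"
      using that by (auto simp: dist_norm norm_minus_commute)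
    have "norm ((f x - f y) $ i) \<le> 4 * M1 / \<rho> * norm (x - y)" for i
    proof -
      have "norm (F (cvec (x - a)) $ i - F (cvec (y - a)) $ i) \<le>
          4 * M1 / \<rho> * norm (cvec (x - a) - cvec (y - a))"
        by (rule bounded_holomorphic_lipschitz[OF F]) (use n in auto)
      moreover have "cvec (x - a) - cvec (y - a) = cvec (x - y)" by (simp add: vec_eq_iff)
      moreover have "F (cvec (x - a)) = cvec (f x)" "F (cvec (y - a)) = cvec (f y)"
        using F2[of "x - a"] F2[of "y - a"] n \<rho> by (auto simp: \<rho>_def)
      ultimately show ?thesis by (simp flip: of_real_diff)
    qed
    then have "(\<Sum>i\<in>UNIV. norm ((f x - f y) $ i)) \<le> (\<Sum>i\<in>(UNIV::'n set). 4 * M1 / \<rho> * norm (x - y))"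
      by (intro sum_mono)
    with norm_le_sum_nth[of "f x - f y"] show ?thesis by simp
  qed
  have der: "(\<Phi> b has_vector_derivative f (\<Phi> b t)) (at t)" if b: "b \<in> ball a (\<rho> / 8)" and t: "\<bar>t\<bar> < \<epsilon>" for b t
  proof -
    have F\<Phi>: "F (Z b (of_real t)) = cvec (f (\<Phi> b t))"
      using F2[of "\<Phi> b t - a"] nrm[OF b t] cv[OF b t] \<rho> by (simp add: \<rho>_def)
    have "((\<lambda>t. \<Phi> b t $ i) has_vector_derivative f (\<Phi> b t) $ i) (at t)" for i
    proof -
      have "((\<lambda>t. Z b (of_real t) $ i) has_vector_derivative F (Z b (of_real t)) $ i) (at t)"
        by (rule has_vector_derivative_real_field[OF Z2[OF b]]) (use t in simp)
      from bounded_linear.has_vector_derivative[OF bounded_linear_Re this]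
      show ?thesis unfolding \<Phi>_def F\<Phi>[unfolded \<Phi>_def] by (auto intro!: derivative_eq_intros)
    qed
    then show ?thesis
      unfolding has_vector_derivative_def has_derivative_componentwise_within[of "\<Phi> b"]
      by (auto simp: Basis_vec_def inner_axis)
  qed
  have hol: "\<exists>G. G holomorphic_on ball 0 \<epsilon> \<and> (\<forall>t. \<bar>t\<bar> < \<epsilon> \<longrightarrow> G (of_real t) = of_real (h (\<Phi> b t) $ j))"
    if b: "b \<in> ball a (\<rho> / 8)" for b j
  proof (intro exI conjI allI impI)
    have "(\<lambda>t. Z b t $ i) holomorphic_on ball 0 \<epsilon>" for i
      using Z2[OF b] by (intro holomorphic_onI) (meson field_differentiable_at_within field_differentiable_def)
    then show "(\<lambda>t. H (Z b t) $ j) holomorphic_on ball 0 \<epsilon>"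
      by (rule bounded_holomorphic_compose[OF H open_ball]) (use Z1[OF b] \<rho> in force)
    fix t assume t: "\<bar>t\<bar> < \<epsilon>"
    show "H (Z b (of_real t)) $ j = of_real (h (\<Phi> b t) $ j)"
      using H2[of "\<Phi> b t - a"] nrm[OF b t] cv[OF b t] \<rho> by (simp add: \<rho>_def)
  qed
  show ?thesis
  proof (rule that[of "\<rho> / 8" \<epsilon> "\<rho> / 4" "CARD('n) * (4 * M1 / \<rho>)" \<Phi>])
    show "\<forall>b\<in>ball a (\<rho> / 8). \<Phi> b 0 = b"
      using Z0 by (simp add: \<Phi>_def vec_eq_iff)
    show "\<forall>b\<in>ball a (\<rho> / 8). \<forall>t. \<bar>t\<bar> < \<epsilon> \<longrightarrow> \<Phi> b t \<in> cball a (\<rho> / 4)"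
      using nrm by (simp add: dist_norm norm_minus_commute)
  qed (use \<rho> \<epsilon> fdiff der hol in auto)
qed

section \<open>Solutions of analytic differential equations\<close>

lemma solves_ode_on_subset:
  assumes "solves_ode_on f \<phi> J" "I \<subseteq> J"
  shows "solves_ode_on f \<phi> I"
  using assms unfolding solves_ode_on_def
  by (meson has_vector_derivative_within_subset subsetD)

lemma solves_ode_on_continuous:
  assumes "solves_ode_on f \<phi> J"
  shows "continuous_on J \<phi>"
  using assms unfolding solves_ode_on_def continuous_on_eq_continuous_within
  by (blast intro: has_vector_derivative_continuous)

lemma solves_ode_on_shift:
  assumes "solves_ode_on f \<phi> J" "\<And>t. t \<in> I \<Longrightarrow> c + t \<in> J"
  shows "solves_ode_on f (\<lambda>t. \<phi> (c + t)) I"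
  unfolding solves_ode_on_def
proof
  fix t assume t: "t \<in> I"
  have sub: "(\<lambda>t. c + t) ` I \<subseteq> J" using assms(2) by auto
  have "(\<phi> has_vector_derivative f (\<phi> (c + t))) (at (c + t) within (\<lambda>t. c + t) ` I)"
    using assms(1) assms(2)[OF t] sub unfolding solves_ode_on_def
    by (blast intro: has_vector_derivative_within_subset)
  moreover have "((\<lambda>t. c + t) has_vector_derivative 1) (at t within I)"
    by (auto intro!: derivative_eq_intros)
  ultimately have "((\<phi> \<circ> (\<lambda>t. c + t)) has_vector_derivative 1 *\<^sub>R f (\<phi> (c + t))) (at t within I)"
    by (intro vector_diff_chain_within)
  then show "((\<lambda>t. \<phi> (c + t)) has_vector_derivative f (\<phi> (c + t))) (at t within I)"
    by (simp add: o_def)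
qed

lemma solves_ode_onI_local:
  assumes "\<And>t. t \<in> J \<Longrightarrow> \<exists>S \<psi>. open S \<and> t \<in> S \<and> (\<forall>u\<in>J \<inter> S. \<psi> u = \<phi> u) \<and> solves_ode_on f \<psi> (J \<inter> S)"
  shows "solves_ode_on f \<phi> J"
  unfolding solves_ode_on_def
proof
  fix t assume t: "t \<in> J"
  obtain S \<psi> where S: "open S" "t \<in> S" "\<And>u. u \<in> J \<inter> S \<Longrightarrow> \<psi> u = \<phi> u" "solves_ode_on f \<psi> (J \<inter> S)"
    using assms[OF t] by blast
  have "(\<psi> has_vector_derivative f (\<psi> t)) (at t within J \<inter> S)"
    using S t unfolding solves_ode_on_def by blast
  then have "(\<phi> has_vector_derivative f (\<phi> t)) (at t within J \<inter> S)"
    using S t by (auto intro: has_vector_derivative_transform_within[OF _ zero_less_one])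
  moreover have "at t within J \<inter> S = at t within J"
    by (rule at_within_nhd[OF S(2,1)]) auto
  ultimately show "(\<phi> has_vector_derivative f (\<phi> t)) (at t within J)" by simp
qed

text \<open>The squared distance w is differentiable even where the solutions meet, and its
  derivative is at most \<open>2 * L * w\<close> in absolute value. Hence w times an exponential is
  monotone, and the bound on both signs of the derivative lets s lie on either side of t.\<close>

lemma gronwall:
  fixes f :: "'a::real_inner \<Rightarrow> 'a"
  assumes \<phi>: "solves_ode_on f \<phi> {a..b}" "\<And>t. t \<in> {a..b} \<Longrightarrow> \<phi> t \<in> S"
    and \<psi>: "solves_ode_on f \<psi> {a..b}" "\<And>t. t \<in> {a..b} \<Longrightarrow> \<psi> t \<in> S"
    and lip: "\<And>x y. x \<in> S \<Longrightarrow> y \<in> S \<Longrightarrow> norm (f x - f y) \<le> L * norm (x - y)"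
    and st: "s \<in> {a..b}" "t \<in> {a..b}"
  shows "norm (\<phi> t - \<psi> t) \<le> norm (\<phi> s - \<psi> s) * exp (L * \<bar>t - s\<bar>)"
proof -
  define w where "w t = (\<phi> t - \<psi> t) \<bullet> (\<phi> t - \<psi> t)" for t
  define w' where "w' t = 2 * ((\<phi> t - \<psi> t) \<bullet> (f (\<phi> t) - f (\<psi> t)))" for t
  have cont: "continuous_on {a..b} w"
    unfolding w_def by (intro continuous_intros solves_ode_on_continuous[OF \<phi>(1)] solves_ode_on_continuous[OF \<psi>(1)])
  have der: "(w has_field_derivative w' u) (at u)" if "a < u" "u < b" for u
  proof -
    have "(\<phi> has_vector_derivative f (\<phi> u)) (at u)" "(\<psi> has_vector_derivative f (\<psi> u)) (at u)"
      using \<phi>(1)[unfolded solves_ode_on_def, rule_format, of u]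
        \<psi>(1)[unfolded solves_ode_on_def, rule_format, of u] that by (simp_all add: at_within_Icc_at)
    then have "((\<lambda>t. \<phi> t - \<psi> t) has_derivative (\<lambda>h. h *\<^sub>R (f (\<phi> u) - f (\<psi> u)))) (at u)"
      using has_vector_derivative_diff has_vector_derivative_def by blast
    from has_derivative_inner[OF this this] show ?thesis
      unfolding w_def w'_def has_field_derivative_def
      by (rule has_derivative_eq_rhs) (auto simp: inner_commute algebra_simps)
  qed
  have w': "\<bar>w' u\<bar> \<le> 2 * L * w u" if "u \<in> {a..b}" for u
  proof -
    have "\<bar>(\<phi> u - \<psi> u) \<bullet> (f (\<phi> u) - f (\<psi> u))\<bar> \<le> norm (\<phi> u - \<psi> u) * norm (f (\<phi> u) - f (\<psi> u))"
      by (rule Cauchy_Schwarz_ineq2)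
    also have "\<dots> \<le> norm (\<phi> u - \<psi> u) * (L * norm (\<phi> u - \<psi> u))"
      using that by (intro mult_left_mono lip \<phi> \<psi>) auto
    also have "\<dots> = L * w u" by (simp add: w_def power2_eq_square flip: power2_norm_eq_inner)
    finally show ?thesis by (simp add: w'_def)
  qed
  have *: "w t \<le> w s * exp (2 * (L * \<bar>t - s\<bar>))"
  proof (cases "s \<le> t")
    case True
    have "w t * exp (- 2 * L * t) \<le> w s * exp (- 2 * L * s)"
    proof (rule DERIV_nonpos_imp_decreasing_open[OF True])
      fix u assume u: "s < u" "u < t"
      have "((\<lambda>t. w t * exp (- 2 * L * t)) has_field_derivative (w' u - 2 * L * w u) * exp (- 2 * L * u)) (at u)"
        using u st by (auto intro!: derivative_eq_intros der simp: algebra_simps)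
      moreover have "(w' u - 2 * L * w u) * exp (- 2 * L * u) \<le> 0"
        using w'[of u] u st by (intro mult_nonpos_nonneg) auto
      ultimately show "\<exists>y. ((\<lambda>t. w t * exp (- 2 * L * t)) has_field_derivative y) (at u) \<and> y \<le> 0" by blast
    next
      show "continuous_on {s..t} (\<lambda>t. w t * exp (- 2 * L * t))"
        using st by (intro continuous_intros continuous_on_subset[OF cont]) auto
    qed
    then have "w t * exp (- 2 * L * t) * exp (2 * L * t) \<le> w s * exp (- 2 * L * s) * exp (2 * L * t)"
      by (rule mult_right_mono) simp
    then show ?thesis using True by (simp add: mult.assoc algebra_simps flip: exp_add)
  next
    case False
    then have ts: "t \<le> s" by simp
    have "w t * exp (2 * L * t) \<le> w s * exp (2 * L * s)"
    proof (rule DERIV_nonneg_imp_increasing_open[OF ts])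
      fix u assume u: "t < u" "u < s"
      have "((\<lambda>t. w t * exp (2 * L * t)) has_field_derivative (w' u + 2 * L * w u) * exp (2 * L * u)) (at u)"
        using u st by (auto intro!: derivative_eq_intros der simp: algebra_simps)
      moreover have "(w' u + 2 * L * w u) * exp (2 * L * u) \<ge> 0"
        using w'[of u] u st by (intro mult_nonneg_nonneg) auto
      ultimately show "\<exists>y. ((\<lambda>t. w t * exp (2 * L * t)) has_field_derivative y) (at u) \<and> 0 \<le> y" by blast
    next
      show "continuous_on {t..s} (\<lambda>t. w t * exp (2 * L * t))"
        using st by (intro continuous_intros continuous_on_subset[OF cont]) auto
    qed
    then have "w t * exp (2 * L * t) * exp (- 2 * L * t) \<le> w s * exp (2 * L * s) * exp (- 2 * L * t)"
      by (rule mult_right_mono) simp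
    then show ?thesis using ts by (simp add: mult.assoc algebra_simps flip: exp_add)
  qed
  have "(norm (\<phi> t - \<psi> t))\<^sup>2 \<le> (norm (\<phi> s - \<psi> s) * exp (L * \<bar>t - s\<bar>))\<^sup>2"
    using * by (simp add: w_def power_mult_distrib flip: power2_norm_eq_inner exp_double)
  then show ?thesis by (rule power2_le_imp_le) simp
qed

lemma convex_backward_interval: "convex (backward_interval \<sigma>)"
proof -
  have "is_interval (backward_interval \<sigma>)"
    unfolding is_interval_1 backward_interval_def
    using less_le_trans[of "- \<sigma>" "ereal _" "ereal _"] by auto
  then show ?thesis by (rule is_interval_convex)
qed

lemma backward_interval_mono:
  assumes "\<sigma> \<le> \<sigma>'"
  shows "backward_interval \<sigma> \<subseteq> backward_interval \<sigma>'"
  unfolding backward_interval_def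
  using le_less_trans[OF ereal_minus_le_minus[THEN iffD2, OF assms]] by auto

lemma zero_in_backward_interval: "0 < \<sigma> \<Longrightarrow> 0 \<in> backward_interval \<sigma>"
  by (cases \<sigma>) (auto simp: backward_interval_def)

locale analytic_system =
  fixes f :: "real^'n \<Rightarrow> real^'n" and h :: "real^'n \<Rightarrow> real^'m"
  assumes f_analytic: "real_analytic f" and h_analytic: "real_analytic h"
begin

lemma local_flow:
  obtains \<delta> \<epsilon> r L \<Phi> where "\<delta> > 0" "\<epsilon> > 0" "r > 0"
    "\<forall>x\<in>cball a r. \<forall>y\<in>cball a r. norm (f x - f y) \<le> L * norm (x - y)"
    "\<forall>b\<in>ball a \<delta>. \<Phi> b 0 = b"
    "\<forall>b\<in>ball a \<delta>. \<forall>t. \<bar>t\<bar> < \<epsilon> \<longrightarrow> \<Phi> b t \<in> cball a r"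
    "\<forall>b\<in>ball a \<delta>. solves_ode_on f (\<Phi> b) {-\<epsilon><..<\<epsilon>}"
    "\<forall>b\<in>ball a \<delta>. \<forall>j. \<exists>G. G holomorphic_on ball 0 \<epsilon> \<and>
        (\<forall>t. \<bar>t\<bar> < \<epsilon> \<longrightarrow> G (of_real t) = of_real (h (\<Phi> b t) $ j))"
proof -
  obtain \<delta> \<epsilon> r L \<Phi> where *: "\<delta> > 0" "\<epsilon> > 0" "r > 0"
    "\<forall>x\<in>cball a r. \<forall>y\<in>cball a r. norm (f x - f y) \<le> L * norm (x - y)"
    "\<forall>b\<in>ball a \<delta>. \<Phi> b 0 = b"
    "\<forall>b\<in>ball a \<delta>. \<forall>t. \<bar>t\<bar> < \<epsilon> \<longrightarrow> \<Phi> b t \<in> cball a r"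
    "\<forall>b\<in>ball a \<delta>. \<forall>t. \<bar>t\<bar> < \<epsilon> \<longrightarrow> (\<Phi> b has_vector_derivative f (\<Phi> b t)) (at t)"
    "\<forall>b\<in>ball a \<delta>. \<forall>j. \<exists>G. G holomorphic_on ball 0 \<epsilon> \<and>
        (\<forall>t. \<bar>t\<bar> < \<epsilon> \<longrightarrow> G (of_real t) = of_real (h (\<Phi> b t) $ j))"
    by (rule analytic_local_flow[OF f_analytic[unfolded real_analytic_def, rule_format]
          h_analytic[unfolded real_analytic_def, rule_format], of a])
  have "\<forall>b\<in>ball a \<delta>. solves_ode_on f (\<Phi> b) {-\<epsilon><..<\<epsilon>}"
    unfolding solves_ode_on_def
  proof (intro ballI)
    fix b t assume bt: "b \<in> ball a \<delta>" "t \<in> {-\<epsilon><..<\<epsilon>}"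
    then have "(\<Phi> b has_vector_derivative f (\<Phi> b t)) (at t)"
      by (intro *(7)[rule_format]) auto
    then show "(\<Phi> b has_vector_derivative f (\<Phi> b t)) (at t within {-\<epsilon><..<\<epsilon>})"
      by (rule has_vector_derivative_at_within)
  qed
  then show ?thesis by (rule that[OF *(1-6) _ *(8)])
qed

lemma local_lipschitz:
  obtains r L where "r > 0"
    "\<forall>x\<in>cball a r. \<forall>y\<in>cball a r. norm (f x - f y) \<le> L * norm (x - y)"
proof -
  obtain \<delta> \<epsilon> r L \<Phi> where "\<delta> > 0" "\<epsilon> > 0" "r > 0"
    "\<forall>x\<in>cball a r. \<forall>y\<in>cball a r. norm (f x - f y) \<le> L * norm (x - y)"
    "\<forall>b\<in>ball a \<delta>. \<Phi> b 0 = b"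
    "\<forall>b\<in>ball a \<delta>. \<forall>t. \<bar>t\<bar> < \<epsilon> \<longrightarrow> \<Phi> b t \<in> cball a r"
    "\<forall>b\<in>ball a \<delta>. solves_ode_on f (\<Phi> b) {-\<epsilon><..<\<epsilon>}"
    "\<forall>b\<in>ball a \<delta>. \<forall>j. \<exists>G. G holomorphic_on ball 0 \<epsilon> \<and>
        (\<forall>t. \<bar>t\<bar> < \<epsilon> \<longrightarrow> G (of_real t) = of_real (h (\<Phi> b t) $ j))"
    by (rule local_flow[of a])
  then show ?thesis by (intro that)
qed

lemma local_analytic_solution:
  obtains \<epsilon> \<phi> where "\<epsilon> > 0" "\<phi> 0 = a" "solves_ode_on f \<phi> {-\<epsilon><..<\<epsilon>}"
    "\<forall>j. \<exists>G. G holomorphic_on ball 0 \<epsilon> \<and>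
        (\<forall>t. \<bar>t\<bar> < \<epsilon> \<longrightarrow> G (of_real t) = of_real (h (\<phi> t) $ j))"
proof -
  obtain \<delta> \<epsilon> r L \<Phi> where "\<delta> > 0" "\<epsilon> > 0" "r > 0"
    "\<forall>x\<in>cball a r. \<forall>y\<in>cball a r. norm (f x - f y) \<le> L * norm (x - y)"
    "\<forall>b\<in>ball a \<delta>. \<Phi> b 0 = b"
    "\<forall>b\<in>ball a \<delta>. \<forall>t. \<bar>t\<bar> < \<epsilon> \<longrightarrow> \<Phi> b t \<in> cball a r"
    "\<forall>b\<in>ball a \<delta>. solves_ode_on f (\<Phi> b) {-\<epsilon><..<\<epsilon>}"
    "\<forall>b\<in>ball a \<delta>. \<forall>j. \<exists>G. G holomorphic_on ball 0 \<epsilon> \<and>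
        (\<forall>t. \<bar>t\<bar> < \<epsilon> \<longrightarrow> G (of_real t) = of_real (h (\<Phi> b t) $ j))"
    by (rule local_flow[of a])
  then show ?thesis by (intro that[of \<epsilon> "\<Phi> a"]) auto
qed

lemma local_solution:
  obtains \<epsilon> \<phi> where "\<epsilon> > 0" "\<phi> 0 = a" "solves_ode_on f \<phi> {-\<epsilon><..<\<epsilon>}"
proof -
  obtain \<epsilon> \<phi> where "\<epsilon> > 0" "\<phi> 0 = a" "solves_ode_on f \<phi> {-\<epsilon><..<\<epsilon>}"
    "\<forall>j. \<exists>G. G holomorphic_on ball 0 \<epsilon> \<and>
        (\<forall>t. \<bar>t\<bar> < \<epsilon> \<longrightarrow> G (of_real t) = of_real (h (\<phi> t) $ j))"
    by (rule local_analytic_solution[of a])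
  then show ?thesis by (intro that)
qed

text \<open>Gronwall's inequality in the ball that contains the local flow and on which f is
  Lipschitz. Halving the time gives closed intervals; K is formed with \<open>\<bar>L\<bar>\<close>
  because the sign of L is not fixed.\<close>

lemma local_flow_lipschitz:
  obtains \<delta> \<epsilon> K \<Phi> where "\<delta> > 0" "\<epsilon> > 0" "\<forall>b\<in>ball a \<delta>. \<Phi> b 0 = b"
    "\<forall>b\<in>ball a \<delta>. solves_ode_on f (\<Phi> b) {-\<epsilon>..\<epsilon>}"
    "\<forall>b\<in>ball a \<delta>. \<forall>c\<in>ball a \<delta>. \<forall>t. \<bar>t\<bar> \<le> \<epsilon> \<longrightarrow>
      norm (\<Phi> b t - \<Phi> c t) \<le> norm (b - c) * K"
proof -
  obtain \<delta> \<epsilon> r L \<Phi> where *: "\<delta> > 0" "\<epsilon> > 0" "r > 0"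
    "\<forall>x\<in>cball a r. \<forall>y\<in>cball a r. norm (f x - f y) \<le> L * norm (x - y)"
    "\<forall>b\<in>ball a \<delta>. \<Phi> b 0 = b"
    "\<forall>b\<in>ball a \<delta>. \<forall>t. \<bar>t\<bar> < \<epsilon> \<longrightarrow> \<Phi> b t \<in> cball a r"
    "\<forall>b\<in>ball a \<delta>. solves_ode_on f (\<Phi> b) {-\<epsilon><..<\<epsilon>}"
    "\<forall>b\<in>ball a \<delta>. \<forall>j. \<exists>G. G holomorphic_on ball 0 \<epsilon> \<and>
        (\<forall>t. \<bar>t\<bar> < \<epsilon> \<longrightarrow> G (of_real t) = of_real (h (\<Phi> b t) $ j))"
    by (rule local_flow[of a])
  have sol: "solves_ode_on f (\<Phi> b) {-(\<epsilon>/2)..\<epsilon>/2}" if "b \<in> ball a \<delta>" for b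
    using *(7)[rule_format, OF that] \<open>\<epsilon> > 0\<close> by (auto intro: solves_ode_on_subset)
  have "norm (\<Phi> b t - \<Phi> c t) \<le> norm (b - c) * exp (\<bar>L\<bar> * \<epsilon>)"
    if b: "b \<in> ball a \<delta>" and c: "c \<in> ball a \<delta>" and t: "\<bar>t\<bar> \<le> \<epsilon> / 2" for b c t
  proof -
    have "norm (\<Phi> b t - \<Phi> c t) \<le> norm (\<Phi> b 0 - \<Phi> c 0) * exp (L * \<bar>t - 0\<bar>)"
      by (rule gronwall[where S = "cball a r", OF sol[OF b] _ sol[OF c] _ *(4)[rule_format]]) (use *(2) *(6)[rule_format, OF b] *(6)[rule_format, OF c] t in auto)
    also have "\<dots> \<le> norm (b - c) * exp (\<bar>L\<bar> * \<epsilon>)"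
    proof (rule mult_mono)
      show "norm (\<Phi> b 0 - \<Phi> c 0) \<le> norm (b - c)" using *(5) b c by simp
      show "exp (L * \<bar>t - 0\<bar>) \<le> exp (\<bar>L\<bar> * \<epsilon>)"
        using t *(2) by (intro iffD2[OF exp_le_cancel_iff] mult_mono) auto
    qed auto
    finally show ?thesis .
  qed
  with sol * show ?thesis by (intro that[of \<delta> "\<epsilon> / 2" \<Phi> "exp (\<bar>L\<bar> * \<epsilon>)"]) auto
qed

text \<open>Coincidence is locally constant in time: near an instant of coincidence it spreads by
  \<open>gronwall\<close>, and near any other instant the solutions stay different by continuity.
  Connectedness of J does the rest, whatever its end points.\<close>

lemma unique_solution:
  assumes \<phi>: "solves_ode_on f \<phi> J" and \<psi>: "solves_ode_on f \<psi> J" and J: "convex J"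
    and s: "s \<in> J" "\<phi> s = \<psi> s" and t: "t \<in> J"
  shows "\<phi> t = \<psi> t"
proof (rule connected_induction_simple[OF convex_connected[OF J] s(1) t, where P = "\<lambda>u. \<phi> u = \<psi> u"])
  show "\<phi> s = \<psi> s" by (fact s)
  fix u assume u: "u \<in> J"
  obtain r L where r: "r > 0" and
    lip: "\<forall>x\<in>cball (\<phi> u) r. \<forall>y\<in>cball (\<phi> u) r. norm (f x - f y) \<le> L * norm (x - y)"
    by (rule local_lipschitz[of "\<phi> u"])
  have c: "continuous_on J \<phi>" "continuous_on J \<psi>"
    using \<phi> \<psi> by (auto intro: solves_ode_on_continuous)
  show "\<exists>T. openin (top_of_set J) T \<and> u \<in> T \<and> (\<forall>x\<in>T. \<forall>y\<in>T. \<phi> x = \<psi> x \<longrightarrow> \<phi> y = \<psi> y)"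
  proof (cases "\<phi> u = \<psi> u")
    case True
    obtain d1 where d1: "d1 > 0" "\<And>v. v \<in> J \<Longrightarrow> dist v u < d1 \<Longrightarrow> dist (\<phi> v) (\<phi> u) < r"
      using c(1) u r unfolding continuous_on_iff by metis
    obtain d2 where d2: "d2 > 0" "\<And>v. v \<in> J \<Longrightarrow> dist v u < d2 \<Longrightarrow> dist (\<psi> v) (\<psi> u) < r"
      using c(2) u r unfolding continuous_on_iff by metis
    define d where "d = min d1 d2"
    have *: "\<phi> y = \<psi> y" if xy: "x \<in> J \<inter> ball u d" "y \<in> J \<inter> ball u d" "\<phi> x = \<psi> x" for x y
    proof -
      have sub: "{min x y..max x y} \<subseteq> J \<inter> ball u d"
      proof -
        have "closed_segment x y \<subseteq> J \<inter> ball u d"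
          using xy J by (intro closed_segment_subset convex_Int) auto
        then show ?thesis by (simp add: closed_segment_eq_real_ivl min_def max_def split: if_splits)
      qed
      have "norm (\<phi> y - \<psi> y) \<le> norm (\<phi> x - \<psi> x) * exp (L * \<bar>y - x\<bar>)"
      proof (rule gronwall[where S = "cball (\<phi> u) r" and a = "min x y" and b = "max x y"])
        show "solves_ode_on f \<phi> {min x y..max x y}" "solves_ode_on f \<psi> {min x y..max x y}"
          using sub \<phi> \<psi> by (auto intro: solves_ode_on_subset)
        fix v assume "v \<in> {min x y..max x y}"
        with sub have v: "v \<in> J" "dist v u < d1" "dist v u < d2" by (auto simp: d_def dist_commute)
        show "\<phi> v \<in> cball (\<phi> u) r" using d1(2)[OF v(1,2)] by (simp add: dist_commute)
        show "\<psi> v \<in> cball (\<phi> u) r" using d2(2)[OF v(1,3)] True by (simp add: dist_commute)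
      qed (use lip in auto)
      then show ?thesis using xy by simp
    qed
    show ?thesis
    proof (intro exI[of _ "J \<inter> ball u d"] conjI ballI impI)
      show "openin (top_of_set J) (J \<inter> ball u d)" by (simp add: openin_open_Int)
      show "u \<in> J \<inter> ball u d" using u d1(1) d2(1) by (simp add: d_def)
    qed (rule *)
  next
    case False
    have "open {z :: (real^'n). z \<noteq> 0}" by (simp add: open_Collect_neq)
    moreover have "continuous_on J (\<lambda>v. \<phi> v - \<psi> v)" by (intro continuous_intros c)
    ultimately have "openin (top_of_set J) (J \<inter> (\<lambda>v. \<phi> v - \<psi> v) -` {z. z \<noteq> 0})"
      by (rule continuous_openin_preimage_gen[rotated])
    then show ?thesis using u False by (intro exI[of _ "J \<inter> (\<lambda>v. \<phi> v - \<psi> v) -` {z. z \<noteq> 0}"]) auto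
  qed
qed

text \<open>By uniqueness the two solutions agree on their overlap before c, so near c the glued
  function is just y, and no one-sided derivatives have to be matched.\<close>

lemma glue_solutions:
  assumes x: "solves_ode_on f x {a..c}" and y: "solves_ode_on f y {b..d}" "y c = x c"
    and abcd: "a \<le> c" "b < c" "c \<le> d"
  shows "solves_ode_on f (\<lambda>t. if t \<le> c then x t else y t) {a..d}"
proof (rule solves_ode_onI_local)
  fix t assume t: "t \<in> {a..d}"
  show "\<exists>S \<psi>. open S \<and> t \<in> S \<and> (\<forall>u\<in>{a..d} \<inter> S. \<psi> u = (if u \<le> c then x u else y u)) \<and>
      solves_ode_on f \<psi> ({a..d} \<inter> S)"
  proof (cases "t < c")
    case True
    then show ?thesis
      using abcd by (intro exI[of _ "{..<c}"] exI[of _ x]) (auto intro!: solves_ode_on_subset[OF x])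
  next
    case False
    have "y u = x u" if "u \<in> {max a b..c}" for u
    proof (rule unique_solution[where J = "{max a b..c}" and s = c])
      show "solves_ode_on f y {max a b..c}" "solves_ode_on f x {max a b..c}"
        using abcd by (auto intro!: solves_ode_on_subset[OF x] solves_ode_on_subset[OF y(1)])
    qed (use abcd that y in auto)
    then show ?thesis
      using abcd False by (intro exI[of _ "{b<..}"] exI[of _ y]) (auto intro!: solves_ode_on_subset[OF y(1)])
  qed
qed

text \<open>The union of all backward solutions, which agree pairwise by uniqueness, over the
  supremum of their lengths. Without existence, the universal quantifiers in
  \<open>backward_indistinguishable\<close> could hold vacuously.\<close>

lemma maximal_backward_solution_exists:
  obtains \<sigma> \<phi> where "maximal_backward_solution f x \<sigma> \<phi>"
proof -
  define A where "A = {\<sigma>. \<exists>\<phi>. backward_solution f x \<sigma> \<phi>}"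
  define \<sigma>m where "\<sigma>m = Sup A"
  have agree: "\<phi> t = \<psi> t" if "backward_solution f x \<sigma> \<phi>" "backward_solution f x \<tau> \<psi>"
    "t \<in> backward_interval \<sigma>" "t \<in> backward_interval \<tau>" for \<phi> \<psi> \<sigma> \<tau> t
  proof (rule unique_solution[where J = "backward_interval (min \<sigma> \<tau>)" and s = 0])
    show "solves_ode_on f \<phi> (backward_interval (min \<sigma> \<tau>))" "solves_ode_on f \<psi> (backward_interval (min \<sigma> \<tau>))"
      using that(1,2) unfolding backward_solution_def
      by (metis solves_ode_on_subset backward_interval_mono min.cobounded1, metis solves_ode_on_subset backward_interval_mono min.cobounded2)
    show "0 \<in> backward_interval (min \<sigma> \<tau>)" "\<phi> 0 = \<psi> 0"
      using that(1,2) by (auto simp: backward_solution_def intro: zero_in_backward_interval)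
    show "t \<in> backward_interval (min \<sigma> \<tau>)" using that by (auto simp: min_def)
  qed (rule convex_backward_interval)
  obtain \<epsilon> \<Phi> where \<epsilon>: "\<epsilon> > 0" "\<Phi> 0 = x" "solves_ode_on f \<Phi> {-\<epsilon><..<\<epsilon>}"
    by (rule local_solution[of x])
  have sol\<Phi>: "backward_solution f x (ereal \<epsilon>) \<Phi>"
    using \<epsilon> unfolding backward_solution_def
    by (auto simp: backward_interval_def intro: solves_ode_on_subset)
  then have "ereal \<epsilon> \<in> A" by (auto simp: A_def)
  then have pos: "0 < \<sigma>m" using \<epsilon>(1) unfolding \<sigma>m_def
    by (meson Sup_upper ereal_less(2) less_le_trans)
  define \<phi> where "\<phi> t = (SOME v. \<exists>\<sigma> \<psi>. backward_solution f x \<sigma> \<psi> \<and> t \<in> backward_interval \<sigma> \<and> v = \<psi> t)" for t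
  have \<phi>: "\<phi> t = \<psi> t" if "backward_solution f x \<sigma> \<psi>" "t \<in> backward_interval \<sigma>" for \<sigma> \<psi> t
  proof -
    have "\<exists>v \<sigma> \<psi>. backward_solution f x \<sigma> \<psi> \<and> t \<in> backward_interval \<sigma> \<and> v = \<psi> t" using that by blast
    from someI_ex[OF this] obtain \<sigma>' \<psi>' where
      "backward_solution f x \<sigma>' \<psi>'" "t \<in> backward_interval \<sigma>'" "\<phi> t = \<psi>' t" unfolding \<phi>_def by blast
    then show ?thesis using agree that by metis
  qed
  have sol: "solves_ode_on f \<phi> (backward_interval \<sigma>m)"
  proof (rule solves_ode_onI_local)
    fix t assume "t \<in> backward_interval \<sigma>m"
    then have t: "ereal (- t) < \<sigma>m" "t \<le> 0"
      unfolding backward_interval_def by (auto simp: ereal_uminus_less_reorder simp flip: uminus_ereal.simps(1))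
    \<comment> \<open>Some solution reaches strictly further back than t; a number e in between
      yields a neighbourhood of t on which that solution represents \<open>\<phi>\<close>.\<close>
    then obtain \<sigma> where "\<sigma> \<in> A" and \<sigma>: "ereal (- t) < \<sigma>" unfolding \<sigma>m_def less_Sup_iff by blast
    then obtain \<psi> where \<psi>: "backward_solution f x \<sigma> \<psi>" by (auto simp: A_def)
    obtain e where e: "- t < e" "ereal e < \<sigma>" using ereal_dense2[OF \<sigma>] by auto
    have "- \<sigma> < ereal u" if "- e < u" for u
    proof -
      have "- ereal u < \<sigma>" using that e(2) less_trans[of "ereal (-u)" "ereal e" \<sigma>] by simp
      then show ?thesis using ereal_uminus_less_reorder by blast
    qed
    then have sub: "backward_interval \<sigma>m \<inter> {-e<..} \<subseteq> backward_interval \<sigma>"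
      unfolding backward_interval_def by auto
    show "\<exists>S \<psi>. open S \<and> t \<in> S \<and> (\<forall>u\<in>backward_interval \<sigma>m \<inter> S. \<psi> u = \<phi> u) \<and>
        solves_ode_on f \<psi> (backward_interval \<sigma>m \<inter> S)"
    proof (intro exI conjI)
      show "solves_ode_on f \<psi> (backward_interval \<sigma>m \<inter> {-e<..})"
        using \<psi> sub unfolding backward_solution_def by (blast intro: solves_ode_on_subset)
    qed (use e \<phi>[OF \<psi>] sub in auto)
  qed
  have "\<phi> 0 = x"
    using \<phi>[OF sol\<Phi>, of 0] \<epsilon> by (simp add: backward_interval_def)
  then have "backward_solution f x \<sigma>m \<phi>" using sol pos by (simp add: backward_solution_def)
  moreover have "\<sigma>' = \<sigma>m" if "backward_solution f x \<sigma>' \<psi>" "\<sigma>m \<le> \<sigma>'" for \<sigma>' \<psi>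
    using that by (intro antisym) (auto simp: \<sigma>m_def A_def intro: Sup_upper)
  ultimately show ?thesis using that unfolding maximal_backward_solution_def by blast
qed

section \<open>Backward indistinguishability\<close>

text \<open>A form of backward indistinguishability that asks for one pair of solutions on one short
  interval. It is easy to establish and evidently transitive;
  \<open>backward_indistinguishable_iff\<close> shows that nothing is lost.\<close>

definition indist :: "real^'n \<Rightarrow> real^'n \<Rightarrow> bool" where
  "indist a b \<longleftrightarrow> (\<exists>e>0. \<exists>\<phi> \<psi>. \<phi> 0 = a \<and> \<psi> 0 = b \<and>
     solves_ode_on f \<phi> {-e..0} \<and> solves_ode_on f \<psi> {-e..0} \<and> (\<forall>t\<in>{-e..0}. h (\<phi> t) = h (\<psi> t)))"

lemma indistI:
  assumes "solves_ode_on f \<phi> {c..d}" "solves_ode_on f \<psi> {c..d}" "c < d"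
    "\<And>t. t \<in> {c..d} \<Longrightarrow> h (\<phi> t) = h (\<psi> t)"
  shows "indist (\<phi> d) (\<psi> d)"
  unfolding indist_def
  using assms
  by (intro exI[of _ "d - c"] exI[of _ "\<lambda>t. \<phi> (d + t)"] exI[of _ "\<lambda>t. \<psi> (d + t)"] conjI)
    (auto intro!: solves_ode_on_shift[where J = "{c..d}"])

lemma indist_imp_h_eq: "indist a b \<Longrightarrow> h a = h b"
  unfolding indist_def by force

lemma indist_sym: "indist a b \<Longrightarrow> indist b a"
  unfolding indist_def by metis

text \<open>On the shorter of the two intervals the solutions through b coincide by uniqueness, so
  their outputs connect the other two.\<close>

lemma indist_trans:
  assumes "indist a b" "indist b c"
  shows "indist a c"
proof -
  obtain e1 \<phi>1 \<psi>1 where 1: "e1 > 0" "\<phi>1 0 = a" "\<psi>1 0 = b"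
    "solves_ode_on f \<phi>1 {-e1..0}" "solves_ode_on f \<psi>1 {-e1..0}" "\<forall>t\<in>{-e1..0}. h (\<phi>1 t) = h (\<psi>1 t)"
    using assms(1) unfolding indist_def by blast
  obtain e2 \<phi>2 \<psi>2 where 2: "e2 > 0" "\<phi>2 0 = b" "\<psi>2 0 = c"
    "solves_ode_on f \<phi>2 {-e2..0}" "solves_ode_on f \<psi>2 {-e2..0}" "\<forall>t\<in>{-e2..0}. h (\<phi>2 t) = h (\<psi>2 t)"
    using assms(2) unfolding indist_def by blast
  define e where "e = min e1 e2"
  have sub: "{-e..0} \<subseteq> {-e1..0}" "{-e..0} \<subseteq> {-e2..0}" by (auto simp: e_def)
  have "\<psi>1 t = \<phi>2 t" if "t \<in> {-e..0}" for t
    by (rule unique_solution[OF solves_ode_on_subset[OF 1(5) sub(1)] solves_ode_on_subset[OF 2(4) sub(2)], of 0])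
      (use that 1 2 in auto)
  then have "h (\<phi>1 t) = h (\<psi>2 t)" if "t \<in> {-e..0}" for t
    using that 1(6) 2(6) sub by (metis subsetD)
  then show ?thesis
    using indistI[OF solves_ode_on_subset[OF 1(4) sub(1)] solves_ode_on_subset[OF 2(5) sub(2)]] 1 2
    by (auto simp: e_def)
qed

text \<open>The local flow extends holomorphically to complex times, so the identity theorem spreads
  coincidence of outputs on a short time interval over the whole interval of existence.\<close>

lemma indist_propagate_local:
  assumes \<phi>: "solves_ode_on f \<phi> J" and \<psi>: "solves_ode_on f \<psi> J" and J: "convex J" and u: "u \<in> J"
  obtains d where "d > 0"
    "\<forall>s\<in>J \<inter> ball u d. \<forall>t\<in>J \<inter> ball u d. indist (\<phi> s) (\<psi> s) \<longrightarrow> indist (\<phi> t) (\<psi> t)"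
proof -
  obtain \<epsilon>1 \<Phi> where 1: "\<epsilon>1 > 0" "\<Phi> 0 = \<phi> u" "solves_ode_on f \<Phi> {-\<epsilon>1<..<\<epsilon>1}"
    "\<forall>j. \<exists>G. G holomorphic_on ball 0 \<epsilon>1 \<and>
        (\<forall>t. \<bar>t\<bar> < \<epsilon>1 \<longrightarrow> G (of_real t) = of_real (h (\<Phi> t) $ j))"
    by (rule local_analytic_solution[of "\<phi> u"])
  obtain \<epsilon>2 \<Psi> where 2: "\<epsilon>2 > 0" "\<Psi> 0 = \<psi> u" "solves_ode_on f \<Psi> {-\<epsilon>2<..<\<epsilon>2}"
    "\<forall>j. \<exists>G. G holomorphic_on ball 0 \<epsilon>2 \<and>
        (\<forall>t. \<bar>t\<bar> < \<epsilon>2 \<longrightarrow> G (of_real t) = of_real (h (\<Psi> t) $ j))"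
    by (rule local_analytic_solution[of "\<psi> u"])
  define \<epsilon> where "\<epsilon> = min \<epsilon>1 \<epsilon>2"
  have \<epsilon>: "\<epsilon> > 0" "\<epsilon> \<le> \<epsilon>1" "\<epsilon> \<le> \<epsilon>2" using 1 2 by (auto simp: \<epsilon>_def)
  have sol: "solves_ode_on f \<Phi> {-\<epsilon><..<\<epsilon>}" "solves_ode_on f \<Psi> {-\<epsilon><..<\<epsilon>}"
    using \<epsilon> by (auto intro: solves_ode_on_subset[OF 1(3)] solves_ode_on_subset[OF 2(3)])
  \<comment> \<open>Uniqueness is applied on the segment from 0 to v only, because J may extend to
    just one side of u.\<close>
  have eq: "Y (u + v) = X v" if "solves_ode_on f Y J" "solves_ode_on f X {-\<epsilon><..<\<epsilon>}" "X 0 = Y u"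
    "\<bar>v\<bar> < \<epsilon>" "u + v \<in> J" for Y X v
  proof (rule unique_solution[where J = "closed_segment 0 v" and s = 0])
    have seg: "u + w \<in> J" "w \<in> {-\<epsilon><..<\<epsilon>}" if w: "w \<in> closed_segment 0 v" for w
    proof -
      have "u + w \<in> closed_segment u (u + v)" using w by (auto simp: in_segment algebra_simps)
      then show "u + w \<in> J" using J u \<open>u + v \<in> J\<close> closed_segment_subset by blast
      show "w \<in> {-\<epsilon><..<\<epsilon>}" using w \<open>\<bar>v\<bar> < \<epsilon>\<close> by (auto simp: closed_segment_eq_real_ivl split: if_splits)
    qed
    show "solves_ode_on f (\<lambda>v. Y (u + v)) (closed_segment 0 v)"
      by (rule solves_ode_on_shift[OF that(1)]) (rule seg)
    show "solves_ode_on f X (closed_segment 0 v)"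
      by (rule solves_ode_on_subset[OF that(2)]) (use seg in blast)
  qed (use that in auto)
  have *: "indist (\<phi> t) (\<psi> t)"
    if s: "s \<in> J" "\<bar>s - u\<bar> < \<epsilon> / 2" and t: "t \<in> J" "\<bar>t - u\<bar> < \<epsilon> / 2" and ind: "indist (\<phi> s) (\<psi> s)" for s t
  proof -
    have at: "\<phi> v = \<Phi> (v - u)" "\<psi> v = \<Psi> (v - u)" if "v \<in> J" "\<bar>v - u\<bar> < \<epsilon> / 2" for v
      using eq[OF \<phi> sol(1) 1(2), of "v - u"] eq[OF \<psi> sol(2) 2(2), of "v - u"] that \<epsilon> by auto
    obtain e0 \<alpha> \<beta> where e0: "e0 > 0" "\<alpha> 0 = \<phi> s" "\<beta> 0 = \<psi> s"
      "solves_ode_on f \<alpha> {-e0..0}" "solves_ode_on f \<beta> {-e0..0}" "\<forall>t\<in>{-e0..0}. h (\<alpha> t) = h (\<beta> t)"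
      using ind unfolding indist_def by blast
    \<comment> \<open>Since \<open>s - u\<close> is below \<open>\<epsilon> / 2\<close> in absolute
      value, going back from it by at most \<open>\<epsilon> / 4\<close> stays within
      \<open>{-\<epsilon><..<\<epsilon>}\<close>.\<close>
    define e where "e = min e0 (\<epsilon> / 4)"
    have e: "e > 0" "e \<le> e0" "e < \<epsilon> / 2" using e0 \<epsilon> by (auto simp: e_def)
    have sh: "s - u + v \<in> {-\<epsilon><..<\<epsilon>}" if "v \<in> {-e..0}" for v
      using that s(2) e unfolding abs_less_iff greaterThanLessThan_iff atLeastAtMost_iff by linarith
    have backward: "Y v = X (s - u + v)" if "solves_ode_on f Y {-e0..0}" "solves_ode_on f X {-\<epsilon><..<\<epsilon>}"
      "Y 0 = X (s - u)" "v \<in> {-e..0}" for Y X v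
    proof (rule unique_solution[where \<phi> = Y and \<psi> = "\<lambda>v. X (s - u + v)" and J = "{-e..0}" and s = 0])
      show "solves_ode_on f Y {-e..0}" using e by (intro solves_ode_on_subset[OF that(1)]) auto
      show "solves_ode_on f (\<lambda>v. X (s - u + v)) {-e..0}"
        by (rule solves_ode_on_shift[OF that(2)]) (rule sh)
    qed (use that e in auto)
    have "\<alpha> 0 = \<Phi> (s - u)" "\<beta> 0 = \<Psi> (s - u)" using at[OF s] e0 by auto
    then have heq: "h (\<Phi> (s - u + v)) = h (\<Psi> (s - u + v))" if "v \<in> {-e..0}" for v
      using backward[OF e0(4) sol(1) _ that] backward[OF e0(5) sol(2) _ that] bspec[OF e0(6), of v] that e
      by simp
    have hall: "h (\<Phi> v) = h (\<Psi> v)" if v: "\<bar>v\<bar> < \<epsilon>" for v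
    proof (subst vec_eq_iff, intro allI)
      fix j
      obtain G1 where G1: "G1 holomorphic_on ball 0 \<epsilon>1"
        "\<And>t. \<bar>t\<bar> < \<epsilon>1 \<Longrightarrow> G1 (of_real t) = of_real (h (\<Phi> t) $ j)" using 1(4) by metis
      obtain G2 where G2: "G2 holomorphic_on ball 0 \<epsilon>2"
        "\<And>t. \<bar>t\<bar> < \<epsilon>2 \<Longrightarrow> G2 (of_real t) = of_real (h (\<Psi> t) $ j)" using 2(4) by metis
      \<comment> \<open>The real segment of complex times at which the outputs are known to agree.
        Being connected with more than one point, it consists of limit points, as the identity
        theorem demands.\<close>
      define I where "I = (of_real ` {s - u - e..s - u} :: complex set)"
      have I\<epsilon>: "\<bar>x\<bar> < \<epsilon>" if "x \<in> {s - u - e..s - u}" for x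
        using sh[of "x - (s - u)"] that by auto
      have "G1 (of_real v) - G2 (of_real v) = 0"
      proof (rule analytic_continuation[where S = "ball 0 \<epsilon>" and U = I and \<xi> = "of_real (s - u)"
            and f = "\<lambda>z. G1 z - G2 z"])
        show "(\<lambda>z. G1 z - G2 z) holomorphic_on ball 0 \<epsilon>"
          using \<epsilon> by (intro holomorphic_on_diff holomorphic_on_subset[OF G1(1)] holomorphic_on_subset[OF G2(1)]) auto
        show "I \<subseteq> ball 0 \<epsilon>" using I\<epsilon> by (auto simp: I_def simp del: of_real_diff)
        show "of_real (s - u) \<in> ball (0::complex) \<epsilon>"
          using I\<epsilon>[of "s - u"] e by (simp del: of_real_diff)
        show "complex_of_real (s - u) islimpt I"
        proof (rule connected_imp_perfect)
          show "connected I" unfolding I_def by (intro connected_continuous_image continuous_intros) simp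
          show "complex_of_real (s - u) \<in> I" using e unfolding I_def by (intro imageI) auto
          have "complex_of_real (s - u - e) \<in> I" using e unfolding I_def by (intro imageI) auto
          moreover have "complex_of_real (s - u - e) \<noteq> complex_of_real (s - u)"
            unfolding of_real_eq_iff using e by simp
          ultimately show "I \<noteq> {x}" for x using \<open>complex_of_real (s - u) \<in> I\<close> by auto
        qed
        show "G1 z - G2 z = 0" if z: "z \<in> I" for z
        proof -
          obtain x where x: "x \<in> {s - u - e..s - u}" "z = of_real x" using z unfolding I_def by blast
          have "h (\<Phi> x) = h (\<Psi> x)" using heq[of "x - (s - u)"] x by auto
          then show ?thesis using I\<epsilon>[OF x(1)] x(2) \<epsilon> G1(2)[of x] G2(2)[of x] by auto
        qed
        show "of_real v \<in> ball (0::complex) \<epsilon>" using v by simp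
      qed auto
      then show "h (\<Phi> v) $ j = h (\<Psi> v) $ j" using G1(2)[of v] G2(2)[of v] v \<epsilon> by simp
    qed
    have tb: "- (\<epsilon> / 2) < t - u" "t - u < \<epsilon> / 2"
      using t(2) unfolding abs_less_iff by linarith+
    have "indist (\<Phi> (t - u)) (\<Psi> (t - u))"
    proof (rule indistI[where c = "t - u - \<epsilon> / 2"])
      show "solves_ode_on f \<Phi> {t - u - \<epsilon> / 2..t - u}" "solves_ode_on f \<Psi> {t - u - \<epsilon> / 2..t - u}"
        using tb by (auto intro!: solves_ode_on_subset[OF sol(1)] solves_ode_on_subset[OF sol(2)])
      fix v assume "v \<in> {t - u - \<epsilon> / 2..t - u}"
      then show "h (\<Phi> v) = h (\<Psi> v)" using tb by (intro hall) (auto simp: abs_less_iff)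
    qed (use \<epsilon> in auto)
    then show ?thesis using at[OF t] by simp
  qed
  show ?thesis
  proof (rule that[of "\<epsilon> / 2"])
    show "\<forall>s\<in>J \<inter> ball u (\<epsilon> / 2). \<forall>t\<in>J \<inter> ball u (\<epsilon> / 2). indist (\<phi> s) (\<psi> s) \<longrightarrow> indist (\<phi> t) (\<psi> t)"
    proof (intro ballI impI)
      fix s t assume "s \<in> J \<inter> ball u (\<epsilon> / 2)" "t \<in> J \<inter> ball u (\<epsilon> / 2)" "indist (\<phi> s) (\<psi> s)"
      then show "indist (\<phi> t) (\<psi> t)"
        by (intro *[of s t]) (simp_all add: dist_norm abs_minus_commute)
    qed
  qed (use \<epsilon> in simp)
qed

text \<open>The local version holds for s and t in either order, so indistinguishability is locally
  constant on the connected set J and spreads to the future as well as to the past.\<close>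

lemma indist_propagate:
  assumes \<phi>: "solves_ode_on f \<phi> J" and \<psi>: "solves_ode_on f \<psi> J" and J: "convex J"
    and s: "s \<in> J" "indist (\<phi> s) (\<psi> s)" and t: "t \<in> J"
  shows "indist (\<phi> t) (\<psi> t)"
proof (rule connected_induction_simple[OF convex_connected[OF J] s(1) t, where P = "\<lambda>u. indist (\<phi> u) (\<psi> u)"])
  fix u assume u: "u \<in> J"
  obtain d where d: "d > 0"
    "\<forall>s\<in>J \<inter> ball u d. \<forall>t\<in>J \<inter> ball u d. indist (\<phi> s) (\<psi> s) \<longrightarrow> indist (\<phi> t) (\<psi> t)"
    by (rule indist_propagate_local[OF \<phi> \<psi> J u])
  have "openin (top_of_set J) (J \<inter> ball u d)" by (simp add: openin_open_Int)
  with d u show "\<exists>T. openin (top_of_set J) T \<and> u \<in> T \<and>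
      (\<forall>x\<in>T. \<forall>y\<in>T. indist (\<phi> x) (\<psi> x) \<longrightarrow> indist (\<phi> y) (\<psi> y))"
    by (intro exI[of _ "J \<inter> ball u d"]) simp
qed (rule s)

text \<open>One direction shortens the maximal solutions to a compact interval. In the other,
  propagation carries the relation from time 0 over the whole common interval, and related states
  have equal outputs.\<close>

lemma backward_indistinguishable_iff: "backward_indistinguishable f h a b \<longleftrightarrow> indist a b"
proof
  assume bi: "backward_indistinguishable f h a b"
  obtain \<sigma> \<phi> where a: "maximal_backward_solution f a \<sigma> \<phi>" by (rule maximal_backward_solution_exists)
  obtain \<tau> \<psi> where b: "maximal_backward_solution f b \<tau> \<psi>" by (rule maximal_backward_solution_exists)
  have sol: "0 < \<sigma>" "\<phi> 0 = a" "solves_ode_on f \<phi> (backward_interval \<sigma>)"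
    "0 < \<tau>" "\<psi> 0 = b" "solves_ode_on f \<psi> (backward_interval \<tau>)"
    using a b unfolding maximal_backward_solution_def backward_solution_def by auto
  have "0 < min \<sigma> \<tau>" using sol by simp
  then obtain e where e: "0 < e" "ereal e < min \<sigma> \<tau>" using ereal_dense2[of 0 "min \<sigma> \<tau>"] by auto
  have sub: "{-e..0} \<subseteq> backward_interval (min \<sigma> \<tau>)"
  proof
    fix t assume t: "t \<in> {-e..0}"
    then have "ereal (- t) \<le> ereal e" by simp
    also note e(2)
    finally have "- min \<sigma> \<tau> < ereal t" by (simp add: ereal_uminus_less_reorder)
    with t show "t \<in> backward_interval (min \<sigma> \<tau>)" by (simp add: backward_interval_def)
  qed
  have "indist (\<phi> 0) (\<psi> 0)"
  proof (rule indistI)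
    show "solves_ode_on f \<phi> {-e..0}" "solves_ode_on f \<psi> {-e..0}"
      using sub backward_interval_mono[OF min.cobounded1[of \<sigma> \<tau>]] backward_interval_mono[OF min.cobounded2[of \<sigma> \<tau>]]
      by (auto intro!: solves_ode_on_subset[OF sol(3)] solves_ode_on_subset[OF sol(6)])
  qed (use e sub bi a b in \<open>auto simp: backward_indistinguishable_def\<close>)
  then show "indist a b" using sol by simp
next
  assume ind: "indist a b"
  show "backward_indistinguishable f h a b"
    unfolding backward_indistinguishable_def
  proof (intro allI impI ballI)
    fix \<sigma> \<phi> \<tau> \<psi> t
    assume a: "maximal_backward_solution f a \<sigma> \<phi>" and b: "maximal_backward_solution f b \<tau> \<psi>"
      and t: "t \<in> backward_interval (min \<sigma> \<tau>)"
    have sol: "0 < \<sigma>" "\<phi> 0 = a" "solves_ode_on f \<phi> (backward_interval \<sigma>)"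
      "0 < \<tau>" "\<psi> 0 = b" "solves_ode_on f \<psi> (backward_interval \<tau>)"
      using a b unfolding maximal_backward_solution_def backward_solution_def by auto
    have "indist (\<phi> t) (\<psi> t)"
      by (rule indist_propagate[OF solves_ode_on_subset[OF sol(3) backward_interval_mono[OF min.cobounded1]]
            solves_ode_on_subset[OF sol(6) backward_interval_mono[OF min.cobounded2]]
            convex_backward_interval zero_in_backward_interval _ t]) (use sol ind in auto)
    then show "h (\<phi> t) = h (\<psi> t)" by (rule indist_imp_h_eq)
  qed
qed

text \<open>Each point has a neighbourhood with a common existence time; compactness leaves finitely
  many times, of which the least is taken.\<close>

lemma uniform_existence_time:
  assumes "compact X"
  obtains \<epsilon> where "\<epsilon> > 0" "\<forall>b\<in>X. \<exists>\<phi>. \<phi> 0 = b \<and> solves_ode_on f \<phi> {-\<epsilon>..\<epsilon>}"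
proof -
  have "\<exists>\<delta>>0. \<exists>\<epsilon>>0. \<forall>b\<in>ball a \<delta>. \<exists>\<phi>. \<phi> 0 = b \<and> solves_ode_on f \<phi> {-\<epsilon>..\<epsilon>}" for a
  proof -
    obtain \<delta> \<epsilon> K \<Phi> where "\<delta> > 0" "\<epsilon> > 0" "\<forall>b\<in>ball a \<delta>. \<Phi> b 0 = b"
      "\<forall>b\<in>ball a \<delta>. solves_ode_on f (\<Phi> b) {-\<epsilon>..\<epsilon>}"
      "\<forall>b\<in>ball a \<delta>. \<forall>c\<in>ball a \<delta>. \<forall>t. \<bar>t\<bar> \<le> \<epsilon> \<longrightarrow> norm (\<Phi> b t - \<Phi> c t) \<le> norm (b - c) * K"
      by (rule local_flow_lipschitz[of a])
    then show ?thesis by metis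
  qed
  then obtain \<delta> \<epsilon> where \<delta>: "\<And>a. \<delta> a > 0" and \<epsilon>: "\<And>a. \<epsilon> a > 0"
    and sol: "\<And>a b. b \<in> ball a (\<delta> a) \<Longrightarrow> \<exists>\<phi>. \<phi> 0 = b \<and> solves_ode_on f \<phi> {-\<epsilon> a..\<epsilon> a}" by metis
  have "X \<subseteq> (\<Union>a\<in>X. ball a (\<delta> a))" using \<delta> by force
  from compactE_image[OF assms _ this] obtain C where C: "C \<subseteq> X" "finite C" "X \<subseteq> (\<Union>a\<in>C. ball a (\<delta> a))"
    by auto
  define e where "e = Min (insert 1 (\<epsilon> ` C))"
  have "e > 0" using C \<epsilon> by (simp add: e_def)
  moreover have "\<exists>\<phi>. \<phi> 0 = b \<and> solves_ode_on f \<phi> {-e..e}" if b: "b \<in> X" for b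
  proof -
    obtain a where a: "a \<in> C" "b \<in> ball a (\<delta> a)" using b C by blast
    have "e \<le> \<epsilon> a" using C a by (simp add: e_def)
    then have "{-e..e} \<subseteq> {-\<epsilon> a..\<epsilon> a}" by auto
    then show ?thesis using sol[OF a(2)] solves_ode_on_subset by blast
  qed
  ultimately show ?thesis using that by blast
qed

lemma extend_solution:
  assumes "solves_ode_on f x {a..c}" "a \<le> c" "\<epsilon> > 0" "\<phi> 0 = x c" "solves_ode_on f \<phi> {-\<epsilon>..\<epsilon>}"
  obtains z where "solves_ode_on f z {a..c + \<epsilon>}" "\<forall>t\<in>{a..c}. z t = x t"
proof
  have "solves_ode_on f (\<lambda>t. \<phi> (- c + t)) {c - \<epsilon>..c + \<epsilon>}"
    by (rule solves_ode_on_shift[OF assms(5)]) auto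
  then show "solves_ode_on f (\<lambda>t. if t \<le> c then x t else \<phi> (- c + t)) {a..c + \<epsilon>}"
    by (rule glue_solutions[OF assms(1)]) (use assms in auto)
qed simp

text \<open>A continuation argument. Compactness excludes blow-up, so \<open>ext\<close> only has to
  show that a solution already known to exist beyond \<open>\<tau>\<close> remains in X for a
  while.\<close>

lemma global_solution_in_compact:
  assumes X: "compact X" and x0: "x0 \<in> X"
    and ext: "\<And>\<tau> e x. t0 \<le> \<tau> \<Longrightarrow> e > 0 \<Longrightarrow> solves_ode_on f x {t0..\<tau> + e} \<Longrightarrow> x t0 = x0 \<Longrightarrow>
      (\<forall>t\<in>{t0..\<tau>}. x t \<in> X) \<Longrightarrow> \<exists>d>0. d \<le> e \<and> (\<forall>t\<in>{\<tau>..\<tau> + d}. x t \<in> X)"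
  obtains x where "solves_ode_on f x {t0..}" "x t0 = x0" "\<forall>t\<ge>t0. x t \<in> X"
proof -
  define P where "P \<tau> x \<longleftrightarrow> solves_ode_on f x {t0..\<tau>} \<and> x t0 = x0 \<and> (\<forall>t\<in>{t0..\<tau>}. x t \<in> X)" for \<tau> x
  define A where "A = {\<tau>. t0 \<le> \<tau> \<and> (\<exists>x. P \<tau> x)}"
  have agree: "x t = z t" if "solves_ode_on f x {t0..\<tau>}" "solves_ode_on f z {t0..\<tau>'}" "x t0 = z t0"
    "t0 \<le> t" "t \<le> \<tau>" "t \<le> \<tau>'" for x z \<tau> \<tau>' t
    by (rule unique_solution[where J = "{t0..t}" and s = t0, OF solves_ode_on_subset[OF that(1)]
          solves_ode_on_subset[OF that(2)]]) (use that in auto)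
  have "solves_ode_on f (\<lambda>_. x0) {t0..t0}"
    by (simp add: solves_ode_on_def has_vector_derivative_def has_derivative_within_singleton_iff
        bounded_linear_scaleR_left)
  then have t0A: "t0 \<in> A" using x0 by (auto simp: A_def P_def intro!: exI[of _ "\<lambda>_. x0"])
  obtain \<epsilon> where \<epsilon>: "\<epsilon> > 0" "\<forall>b\<in>X. \<exists>\<phi>. \<phi> 0 = b \<and> solves_ode_on f \<phi> {-\<epsilon>..\<epsilon>}"
    by (rule uniform_existence_time[OF X])
  have "\<not> bdd_above A"
  proof
    assume bdd: "bdd_above A"
    define s where "s = Sup A"
    have up: "\<tau> \<le> s" if "\<tau> \<in> A" for \<tau> unfolding s_def by (rule cSup_upper[OF that bdd])
    have ts: "t0 \<le> s" by (rule up[OF t0A])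
    \<comment> \<open>Restarting this close to the supremum with the uniform existence time
      \<open>\<epsilon>\<close> gives a solution that exists beyond s.\<close>
    have "\<exists>\<tau>\<in>A. s - \<epsilon> / 2 < \<tau>"
      using t0A \<epsilon>(1) less_cSup_iff[OF _ bdd, of "s - \<epsilon> / 2"] unfolding s_def by auto
    then obtain \<tau> x where \<tau>: "\<tau> \<in> A" "s - \<epsilon> / 2 < \<tau>" "P \<tau> x" unfolding A_def by blast
    have \<tau>0: "t0 \<le> \<tau>" using \<tau> by (simp add: A_def)
    have sol\<tau>: "solves_ode_on f x {t0..\<tau>}" using \<tau>(3) by (simp add: P_def)
    have "x \<tau> \<in> X" using \<tau>(3) \<tau>0 by (auto simp: P_def)
    then obtain \<phi> where \<phi>: "\<phi> 0 = x \<tau>" "solves_ode_on f \<phi> {-\<epsilon>..\<epsilon>}" using \<epsilon>(2) by blast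
    obtain z where z: "solves_ode_on f z {t0..\<tau> + \<epsilon>}" "\<forall>t\<in>{t0..\<tau>}. z t = x t"
      by (rule extend_solution[OF sol\<tau> \<tau>0 \<epsilon>(1) \<phi>])
    have z0: "z t0 = x0" using z(2) \<tau>(3) \<tau>0 by (simp add: P_def)
    have before: "z t \<in> X" if t: "t0 \<le> t" "t < s" for t
    proof -
      obtain \<tau>' w where \<tau>': "t < \<tau>'" "P \<tau>' w"
        using less_cSup_iff[OF _ bdd, of t] t0A t(2) unfolding s_def A_def by auto
      have "z t = w t"
        by (rule agree[OF z(1)]) (use \<tau>' t \<tau> z0 \<epsilon>(1) in \<open>auto simp: P_def\<close>)
      then show ?thesis using \<tau>' t by (auto simp: P_def)
    qed
    have s_in: "s < \<tau> + \<epsilon>" using \<tau>(2) \<epsilon>(1) by simp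
    \<comment> \<open>X is closed, so the limit from the left belongs to it; at
      \<open>s = t0\<close> there is no left side and the initial value is used.\<close>
    have "z s \<in> X"
    proof (cases "s = t0")
      case False
      have "continuous (at s within {t0..<s}) z"
        using solves_ode_on_continuous[OF solves_ode_on_subset[OF z(1)], of "{t0..s}"] s_in ts
        by (intro continuous_within_subset[of s "{t0..s}" z "{t0..<s}"])
          (auto simp: continuous_on_eq_continuous_within)
      then have "(z \<longlongrightarrow> z s) (at s within {t0..<s})" by (simp add: continuous_within)
      moreover have "at s within {t0..<s} \<noteq> bot"
        using ts False by (simp add: trivial_limit_within)
      moreover have "\<forall>\<^sub>F t in at s within {t0..<s}. z t \<in> X"
        using before by (auto simp: eventually_at intro!: exI[of _ 1])
      ultimately show ?thesis
        using Lim_in_closed_set[OF compact_imp_closed[OF X]] by blast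
    qed (use z0 x0 in simp)
    with before have in_X: "\<forall>t\<in>{t0..s}. z t \<in> X" by (metis atLeastAtMost_iff less_eq_real_def)
    obtain d where d: "d > 0" "d \<le> \<tau> + \<epsilon> - s" "\<forall>t\<in>{s..s + d}. z t \<in> X"
      using ext[OF ts _ _ z0 in_X, of "\<tau> + \<epsilon> - s"] z(1) s_in by auto
    have "P (s + d) z"
      unfolding P_def using d in_X z0
      by (auto intro!: solves_ode_on_subset[OF z(1)])
    then have "s + d \<in> A" using ts d by (auto simp: A_def)
    from up[OF this] d show False by simp
  qed
  then have "\<exists>x. P \<tau> x" if "t0 \<le> \<tau>" for \<tau>
  proof -
    obtain \<tau>' where "\<tau>' \<in> A" "\<tau> < \<tau>'" using \<open>\<not> bdd_above A\<close> by (meson bdd_above_def not_le bdd_above.I)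
    then show ?thesis unfolding A_def P_def
      by (force intro: solves_ode_on_subset)
  qed
  then obtain S where S: "\<And>\<tau>. t0 \<le> \<tau> \<Longrightarrow> P \<tau> (S \<tau>)" by metis
  show ?thesis
  \<comment> \<open>The solutions \<open>S \<tau>\<close> on growing intervals are compatible by
    uniqueness, so the diagonal agrees near each t with the single solution
    \<open>S (t + 1)\<close>.\<close>
  proof (rule that[of "\<lambda>t. S t t"])
    show "solves_ode_on f (\<lambda>t. S t t) {t0..}"
    proof (rule solves_ode_onI_local)
      fix t assume t: "t \<in> {t0..}"
      show "\<exists>U \<psi>. open U \<and> t \<in> U \<and> (\<forall>u\<in>{t0..} \<inter> U. \<psi> u = S u u) \<and> solves_ode_on f \<psi> ({t0..} \<inter> U)"
      proof (intro exI conjI ballI)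
        show "solves_ode_on f (S (t + 1)) ({t0..} \<inter> {..<t + 1})"
          using S[of "t + 1"] t by (auto simp: P_def intro: solves_ode_on_subset)
        fix u assume u: "u \<in> {t0..} \<inter> {..<t + 1}"
        show "S (t + 1) u = S u u"
          by (rule agree[where \<tau> = "t + 1" and \<tau>' = u]) (use S[of "t + 1"] S[of u] u t in \<open>auto simp: P_def\<close>)
      qed auto
    qed
    show "S t0 t0 = x0" "\<forall>t\<ge>t0. S t t \<in> X" using S by (auto simp: P_def)
  qed
qed

end

section \<open>Fibres and contingent cones\<close>

text \<open>Full column rank gives the Jacobian a left inverse, enough for injectivity on a small
  ball even when it is not square. A Lebesgue number of the cover by such balls makes the radius
  uniform on X.\<close>

lemma uniformly_locally_injective:
  fixes T :: "real^'n \<Rightarrow> real^'k"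
  assumes C1: "C1_on_with_jacobian T J S" and X: "compact X" "X \<subseteq> S"
    and rank: "\<forall>x\<in>X. rank (J x) = CARD('n)"
  obtains \<delta> where "\<delta> > 0" "\<forall>x\<in>X. \<forall>y\<in>X. T x = T y \<longrightarrow> dist x y < \<delta> \<longrightarrow> x = y"
proof -
  obtain W g G where W: "open W" "S \<subseteq> W"
    and der: "\<And>x. x \<in> W \<Longrightarrow> (g has_derivative (\<lambda>v. G x *v v)) (at x)"
    and contG: "continuous_on W G" and eq: "\<And>x. x \<in> S \<Longrightarrow> g x = T x \<and> G x = J x"
    using C1 unfolding C1_on_with_jacobian_def by blast
  have "\<exists>r>0. inj_on g (ball a r)" if a: "a \<in> X" for a
  proof -
    have aW: "a \<in> W" using a X W by blast
    have "inj ((*v) (G a))" using rank a eq X by (metis full_rank_injective subsetD)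
    then obtain B where B: "B ** G a = mat 1" using matrix_left_invertible_injective by blast
    show ?thesis
    proof (rule has_derivative_locally_injective[of a W "(*v) B" "\<lambda>x v. G x *v v" g])
      show "(*v) B \<circ> (*v) (G a) = id"
        using B by (auto simp: fun_eq_iff matrix_vector_mul_assoc)
      fix e :: real assume e: "e > 0"
      \<comment> \<open>The entrywise sum bounds the operator norm, so continuity of the entries of
        G controls \<open>onorm\<close>.\<close>
      define N where "N x = (\<Sum>i\<in>UNIV. \<Sum>j\<in>UNIV. \<bar>(G x - G a) $ i $ j\<bar>)" for x
      have "continuous_on W N" unfolding N_def by (intro continuous_intros contG)
      then have "continuous (at a) N" using W(1) aW by (simp add: continuous_on_eq_continuous_at)
      moreover have "N a = 0" by (simp add: N_def)
      ultimately obtain d where d: "d > 0" "\<And>x. dist x a < d \<Longrightarrow> \<bar>N x\<bar> < e"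
        using e unfolding continuous_at_eps_delta by (metis dist_0_norm dist_commute real_norm_def)
      have "onorm (\<lambda>v. G x *v v - G a *v v) < e" if "dist a x < d" for x
      proof -
        have "onorm (\<lambda>v. (G x - G a) *v v) \<le> N x" unfolding N_def by (rule onorm_le_matrix_component_sum)
        also have "\<dots> < e" using d(2)[of x] that by (simp add: dist_commute)
        finally show ?thesis by (simp add: matrix_vector_mult_diff_rdistrib)
      qed
      then show "\<exists>d>0. \<forall>x. dist a x < d \<longrightarrow> onorm (\<lambda>v. G x *v v - G a *v v) < e" using d(1) by blast
    qed (use aW W der in auto)
  qed
  then obtain r where r: "\<And>a. a \<in> X \<Longrightarrow> r a > 0 \<and> inj_on g (ball a (r a))" by metis
  have cover: "X \<subseteq> \<Union>((\<lambda>a. ball a (r a)) ` X)" using r by force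
  obtain \<delta> where \<delta>: "\<delta> > 0" "\<And>x. x \<in> X \<Longrightarrow> \<exists>U\<in>(\<lambda>a. ball a (r a)) ` X. ball x \<delta> \<subseteq> U"
    using Heine_Borel_lemma[OF X(1) cover] by blast
  have "x = y" if xy: "x \<in> X" "y \<in> X" "T x = T y" "dist x y < \<delta>" for x y
  proof -
    obtain a where a: "a \<in> X" "ball x \<delta> \<subseteq> ball a (r a)" using \<delta>(2)[OF xy(1)] by blast
    have "x \<in> ball a (r a)" "y \<in> ball a (r a)" using a(2) xy(4) \<delta>(1) by (meson centre_in_ball mem_ball subsetD)+
    moreover have "g x = g y" using eq xy X by (metis subsetD)
    ultimately show ?thesis using r[OF a(1)] by (meson inj_onD)
  qed
  then show ?thesis using that \<delta>(1) by blast
qed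

lemma C1_on_with_jacobian_continuous:
  assumes "C1_on_with_jacobian T J S" "X \<subseteq> S"
  shows "continuous_on X T"
proof -
  obtain W g G where W: "S \<subseteq> W"
    and der: "\<And>x. x \<in> W \<Longrightarrow> (g has_derivative (\<lambda>v. G x *v v)) (at x)"
    and eq: "\<And>x. x \<in> S \<Longrightarrow> g x = T x \<and> G x = J x"
    using assms(1) unfolding C1_on_with_jacobian_def by blast
  have "continuous_on X g"
    using der W assms(2) by (intro continuous_at_imp_continuous_on) (blast intro: has_derivative_continuous)
  then show ?thesis by (rule continuous_on_eq) (use eq assms(2) in auto)
qed

text \<open>Small balls around the p points of the fibre through x contain at most one point each of a
  nearby fibre, and cover it; as that fibre also has p points, no ball is missed.\<close>

lemma fibre_lower_semicontinuous:
  fixes T :: "'a::metric_space \<Rightarrow> 'b::metric_space"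
  assumes X: "compact X" and T: "continuous_on X T" and p: "p > 0"
    and card: "\<And>z. z \<in> T ` X \<Longrightarrow> card (fibre T X z) = p"
    and \<delta>: "\<delta> > 0" and sep: "\<And>x y. x \<in> X \<Longrightarrow> y \<in> X \<Longrightarrow> T x = T y \<Longrightarrow> dist x y < \<delta> \<Longrightarrow> x = y"
    and x: "x \<in> X" and e: "e > 0"
  obtains d where "d > 0" "\<forall>z\<in>T ` X. dist z (T x) < d \<longrightarrow> (\<exists>q\<in>fibre T X z. dist q x < e)"
proof -
  define F where "F = fibre T X (T x)"
  \<comment> \<open>Two points of one fibre in the same ball of this radius are closer than
    \<open>\<delta>\<close>, hence equal.\<close>
  define \<eta> where "\<eta> = min e (\<delta> / 2)"
  have \<eta>: "\<eta> > 0" using e \<delta> by (simp add: \<eta>_def)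
  have fin: "finite (fibre T X z)" if "z \<in> T ` X" for z
    using card[OF that] p by (metis card.infinite less_irrefl)
  define V where "V = (\<Union>a\<in>F. ball a \<eta>)"
  have FV: "F \<subseteq> V" using \<eta> by (force simp: V_def)
  \<comment> \<open>The image of \<open>X - V\<close> is closed and misses \<open>T x\<close>, so
    every fibre over a point near \<open>T x\<close> lies in V.\<close>
  have "compact (X - V)" unfolding V_def by (intro compact_diff X) auto
  then have "compact (T ` (X - V))" by (intro compact_continuous_image continuous_on_subset[OF T]) auto
  then have "open (- T ` (X - V))" by (simp add: compact_imp_closed open_Compl)
  moreover have "T x \<in> - T ` (X - V)" using FV by (force simp: F_def fibre_def)
  ultimately obtain d where d: "d > 0" "ball (T x) d \<subseteq> - T ` (X - V)" by (meson open_contains_ball)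
  have "\<exists>q\<in>fibre T X z. dist q x < e" if z: "z \<in> T ` X" "dist z (T x) < d" for z
  proof -
    have "\<exists>a\<in>F. dist a w < \<eta>" if w: "w \<in> fibre T X z" for w
    proof -
      have "z \<in> ball (T x) d" using z(2) by (simp add: dist_commute)
      then have "z \<notin> T ` (X - V)" using d(2) by blast
      then have "w \<in> V" using w by (auto simp: fibre_def)
      then show ?thesis by (auto simp: V_def)
    qed
    then obtain \<pi> where \<pi>: "\<And>w. w \<in> fibre T X z \<Longrightarrow> \<pi> w \<in> F \<and> dist (\<pi> w) w < \<eta>" by metis
    have "inj_on \<pi> (fibre T X z)"
    proof (rule inj_onI)
      fix u w assume uw: "u \<in> fibre T X z" "w \<in> fibre T X z" "\<pi> u = \<pi> w"
      have "dist u w \<le> dist (\<pi> u) u + dist (\<pi> u) w" by (metis dist_commute dist_triangle)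
      also have "\<dots> < \<eta> + \<eta>" using \<pi> uw by (metis add_strict_mono)
      also have "\<dots> \<le> \<delta>" by (simp add: \<eta>_def)
      finally show "u = w" using sep uw by (auto simp: fibre_def)
    qed
    then have "card (\<pi> ` fibre T X z) = card F"
      using card[OF z(1)] card[of "T x"] x by (simp add: card_image F_def)
    \<comment> \<open>An injection between two sets of p points is onto, so some point of the nearby
      fibre is assigned to x itself.\<close>
    then have "\<pi> ` fibre T X z = F"
      using \<pi> fin[of "T x"] x by (intro card_subset_eq) (auto simp: F_def)
    moreover have "x \<in> F" using x by (simp add: F_def fibre_def)
    ultimately obtain q where "q \<in> fibre T X z" "\<pi> q = x" by blast
    then show ?thesis using \<pi>[of q] by (auto simp: \<eta>_def dist_commute)
  qed
  then show ?thesis using that d(1) by blast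
qed

lemma infdist_gt_if_not_in_contingent_cone:
  assumes "v \<notin> contingent_cone K x"
  obtains c where "c > 0" "\<forall>\<^sub>F s in at_right 0. c * s < infdist (x + s *\<^sub>R v) K"
proof -
  let ?L = "Liminf (at_right 0) (\<lambda>s. ereal (infdist (x + s *\<^sub>R v) K / s))"
  have pos: "\<forall>\<^sub>F s in at_right (0::real). s > 0" by (simp add: eventually_at_right_less)
  have "0 \<le> ?L"
    by (intro Liminf_bounded eventually_mono[OF pos]) (simp add: infdist_nonneg)
  moreover have "?L \<noteq> 0" using assms by (simp add: contingent_cone_def)
  ultimately have "0 < ?L" by simp
  then obtain c where c: "0 < ereal c" "ereal c < ?L" using ereal_dense2 by blast
  have "\<forall>\<^sub>F s in at_right 0. ereal c < ereal (infdist (x + s *\<^sub>R v) K / s)"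
    by (rule less_LiminfD[OF c(2)])
  with pos have "\<forall>\<^sub>F s in at_right 0. c * s < infdist (x + s *\<^sub>R v) K"
    by eventually_elim (simp add: pos_less_divide_eq)
  with c(1) show ?thesis by (intro that) auto
qed

lemma infdist_lt_if_in_contingent_cone:
  assumes "v \<in> contingent_cone K x" "c > 0"
  shows "\<exists>\<^sub>F s in at_right 0. infdist (x + s *\<^sub>R v) K < c * s"
  unfolding frequently_def
proof
  have pos: "\<forall>\<^sub>F s in at_right (0::real). s > 0" by (simp add: eventually_at_right_less)
  assume "\<forall>\<^sub>F s in at_right 0. \<not> infdist (x + s *\<^sub>R v) K < c * s"
  with pos have "\<forall>\<^sub>F s in at_right 0. ereal c \<le> ereal (infdist (x + s *\<^sub>R v) K / s)"
    by eventually_elim (simp add: pos_le_divide_eq)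
  from Liminf_bounded[OF this] show False using assms by (simp add: contingent_cone_def)
qed

lemma eventually_close_to_tangent:
  assumes der: "(\<phi> has_vector_derivative v) (at 0 within {0..e})" and e: "e > 0" and c: "c > 0"
  shows "\<forall>\<^sub>F s in at_right 0. dist (\<phi> s) (\<phi> 0 + s *\<^sub>R v) < c * s"
proof -
  obtain d where d: "d > 0" "\<And>s. s \<in> {0..e} \<Longrightarrow> norm (s - 0) < d \<Longrightarrow>
      norm (\<phi> s - \<phi> 0 - (s - 0) *\<^sub>R v) \<le> c / 2 * norm (s - 0)"
    using der half_gt_zero[OF c] unfolding has_vector_derivative_def has_derivative_within_alt by meson
  show ?thesis
    unfolding eventually_at_right_field
  proof (intro exI[of _ "min d e"] conjI allI impI)
    fix s :: real assume s: "0 < s" "s < min d e"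
    then have "dist (\<phi> s) (\<phi> 0 + s *\<^sub>R v) \<le> c / 2 * s"
      using d(2)[of s] by (simp add: dist_norm algebra_simps)
    also have "\<dots> < c * s" using c s by simp
    finally show "dist (\<phi> s) (\<phi> 0 + s *\<^sub>R v) < c * s" .
  qed (use d e in auto)
qed

text \<open>The tangent ray recedes from K at some linear rate c, and the curve eventually deviates
  from the ray by less than \<open>c * s\<close>.\<close>

lemma avoids_if_not_in_contingent_cone:
  assumes der: "(\<phi> has_vector_derivative v) (at 0 within {0..e})" and e: "e > 0"
    and v: "v \<notin> contingent_cone K (\<phi> 0)"
  shows "\<forall>\<^sub>F s in at_right 0. \<phi> s \<notin> K"
proof -
  obtain c where c: "c > 0" "\<forall>\<^sub>F s in at_right 0. c * s < infdist (\<phi> 0 + s *\<^sub>R v) K"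
    by (rule infdist_gt_if_not_in_contingent_cone[OF v])
  from c(2) eventually_close_to_tangent[OF der e c(1)] show ?thesis
  proof eventually_elim
    case (elim s)
    then show ?case
      using infdist_le[of "\<phi> s" K "\<phi> 0 + s *\<^sub>R v"] by (auto simp: dist_commute)
  qed
qed

text \<open>A ball around a point of the tangent ray that meets X but misses its frontier lies in X
  by connectedness, which puts one point of the curve into X. The curve avoids the frontier at small
  positive times, so connectedness applies again to the whole arc.\<close>

lemma enters_if_in_contingent_cone:
  fixes \<phi> :: "real \<Rightarrow> 'a::real_normed_vector"
  assumes der: "(\<phi> has_vector_derivative v) (at 0 within {0..e})" and e: "e > 0"
    and cont: "continuous_on {0..e} \<phi>" and X: "closed X" "\<phi> 0 \<in> X"
    and v: "v \<in> contingent_cone X (\<phi> 0)" "v \<notin> contingent_cone (frontier X) (\<phi> 0)"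
  obtains d where "d > 0" "d \<le> e" "\<forall>s\<in>{0<..<d}. \<phi> s \<in> interior X"
proof -
  obtain c where c: "c > 0" "\<forall>\<^sub>F s in at_right 0. c * s < infdist (\<phi> 0 + s *\<^sub>R v) (frontier X)"
    by (rule infdist_gt_if_not_in_contingent_cone[OF v(2)])
  have "\<forall>\<^sub>F s in at_right 0. \<phi> s \<notin> frontier X"
    by (rule avoids_if_not_in_contingent_cone[OF der e v(2)])
  then obtain d0 where d0: "d0 > 0" "\<And>s. 0 < s \<Longrightarrow> s < d0 \<Longrightarrow> \<phi> s \<notin> frontier X"
    unfolding eventually_at_right_field by blast
  define d where "d = min d0 e"
  have "\<forall>\<^sub>F s in at_right 0. s \<in> {0<..<d}"
    unfolding eventually_at_right_field using d0 e by (intro exI[of _ d]) (simp add: d_def)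
  \<comment> \<open>The vanishing liminf makes the ray close to X only at some arbitrarily small s.
    One such s is enough, since the other requirements hold eventually.\<close>
  from frequently_eventually_frequently[OF infdist_lt_if_in_contingent_cone[OF v(1) c(1)]
      eventually_conj[OF this eventually_conj[OF c(2) eventually_close_to_tangent[OF der e c(1)]]]]
  obtain s where s: "infdist (\<phi> 0 + s *\<^sub>R v) X < c * s" "s \<in> {0<..<d}"
    "c * s < infdist (\<phi> 0 + s *\<^sub>R v) (frontier X)" "dist (\<phi> s) (\<phi> 0 + s *\<^sub>R v) < c * s"
    by (auto dest!: frequently_ex)
  let ?B = "ball (\<phi> 0 + s *\<^sub>R v) (c * s)"
  have "?B \<inter> frontier X = {}" using s(3) infdist_le[of _ "frontier X" "\<phi> 0 + s *\<^sub>R v"] by fastforce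
  moreover have "?B \<inter> X \<noteq> {}"
  proof -
    have "X \<noteq> {}" using X(2) by blast
    then have "(INF y\<in>X. dist (\<phi> 0 + s *\<^sub>R v) y) < c * s" using s(1) by (simp add: infdist_notempty)
    then show ?thesis using \<open>X \<noteq> {}\<close> by (subst (asm) cINF_less_iff) auto
  qed
  ultimately have "?B \<subseteq> X" using connected_Int_frontier[of ?B X] by auto
  then have sX: "\<phi> s \<in> X" using s(4) by (auto simp: dist_commute)
  have I: "\<phi> ` {0<..<d} \<inter> frontier X = {}" using d0 by (auto simp: d_def)
  have "connected (\<phi> ` {0<..<d})"
    by (intro connected_continuous_image continuous_on_subset[OF cont]) (auto simp: d_def)
  then have "\<phi> ` {0<..<d} \<subseteq> X"
    using connected_Int_frontier[of "\<phi> ` {0<..<d}" X] I sX s(2) by blast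
  then have "\<phi> ` {0<..<d} \<subseteq> interior X" using I X(1) by (auto simp: frontier_def)
  then show ?thesis using d0 e by (intro that[of d]) (auto simp: d_def)
qed

section \<open>Solutions generating a given output\<close>

text \<open>The hypotheses on T in the form used from here on: the rank condition A2 is represented
  by the separation constant \<open>\<delta>\<close>, and A3 is phrased with the transitive
  \<open>indist\<close>.\<close>

locale indistinguishability_map = analytic_system f h
  for f :: "real^'n \<Rightarrow> real^'n" and h :: "real^'n \<Rightarrow> real^'m" +
  fixes T :: "real^'n \<Rightarrow> real^'k" and X :: "(real^'n) set" and p :: nat and \<delta> :: real
  assumes X_compact: "compact X" and T_continuous: "continuous_on X T" and p_pos: "p > 0"
    and card_fibre: "z \<in> T ` X \<Longrightarrow> card (fibre T X z) = p"
    and \<delta>_pos: "\<delta> > 0"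
    and separated: "x \<in> X \<Longrightarrow> x' \<in> X \<Longrightarrow> T x = T x' \<Longrightarrow> dist x x' < \<delta> \<Longrightarrow> x = x'"
    and T_eq_iff_indist: "x \<in> X \<Longrightarrow> x' \<in> X \<Longrightarrow> T x = T x' \<longleftrightarrow> indist x x'"
begin

text \<open>Points of X near x in the fibres over W t are flowed back by a fixed time s. There they are
  close to the solution through x, inside X, and indistinguishable from it, hence on it.\<close>

lemma stays_if_comes_from_interior:
  assumes x: "x \<in> X" and \<eta>: "\<eta> > 0" and W: "solves_ode_on f W {-\<eta>..\<eta>}" "\<forall>t\<in>{0..\<eta>}. W t \<in> X"
    and ind: "indist x (W 0)" and \<phi>: "solves_ode_on f \<phi> {-\<eta>..\<eta>}" "\<phi> 0 = x"
    and int: "\<forall>\<^sub>F s in at_right 0. \<phi> (- s) \<in> interior X"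
  obtains d where "d > 0" "\<forall>t\<in>{0..d}. \<phi> t \<in> X"
proof -
  obtain \<rho> \<epsilon> K \<Phi> where \<Phi>: "\<rho> > 0" "\<epsilon> > 0" "\<forall>b\<in>ball x \<rho>. \<Phi> b 0 = b"
    "\<forall>b\<in>ball x \<rho>. solves_ode_on f (\<Phi> b) {-\<epsilon>..\<epsilon>}"
    "\<forall>b\<in>ball x \<rho>. \<forall>c\<in>ball x \<rho>. \<forall>t. \<bar>t\<bar> \<le> \<epsilon> \<longrightarrow> norm (\<Phi> b t - \<Phi> c t) \<le> norm (b - c) * K"
    by (rule local_flow_lipschitz[of x])
  have "\<forall>\<^sub>F s in at_right 0. 0 < s \<and> s < min \<epsilon> \<eta>"
    unfolding eventually_at_right_field using \<Phi>(2) \<eta> by (intro exI[of _ "min \<epsilon> \<eta>"]) simp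
  from eventually_happens[OF eventually_conj[OF int this]]
  obtain s where s: "0 < s" "s < \<epsilon>" "s < \<eta>" "\<phi> (- s) \<in> interior X" by auto
  then obtain r0 where r0: "r0 > 0" "ball (\<phi> (- s)) r0 \<subseteq> X" by (auto simp: mem_interior)
  \<comment> \<open>Points within r of \<open>\<phi> (- s)\<close> belong to X, where T decides
    indistinguishability, and are mutually closer than \<open>\<delta>\<close>, where T
    separates.\<close>
  define r where "r = min r0 (\<delta> / 2)"
  have r: "r > 0" "ball (\<phi> (- s)) r \<subseteq> X" using r0 \<delta>_pos by (auto simp: r_def)
  \<comment> \<open>Makes the local flow move points within e of x by time \<open>- s\<close> to
    within r of \<open>\<phi> (- s)\<close>.\<close>
  define e where "e = min \<rho> (r / (\<bar>K\<bar> + 1))"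
  have e: "e > 0" using \<Phi>(1) r by (simp add: e_def)
  have eK: "norm v * K < r" if "norm v < e" for v :: "real^'n"
  proof -
    have "norm v * K \<le> norm v * (\<bar>K\<bar> + 1)" by (intro mult_left_mono) auto
    also have "\<dots> < r / (\<bar>K\<bar> + 1) * (\<bar>K\<bar> + 1)" using that by (intro mult_strict_right_mono) (auto simp: e_def)
    finally show ?thesis by simp
  qed
  obtain d1 where d1: "d1 > 0" "\<forall>z\<in>T ` X. dist z (T x) < d1 \<longrightarrow> (\<exists>q\<in>fibre T X z. dist q x < e)"
    by (rule fibre_lower_semicontinuous[OF X_compact T_continuous p_pos card_fibre \<delta>_pos separated x e])
  have TW: "continuous_on {0..\<eta>} (\<lambda>t. T (W t))"
    by (rule continuous_on_compose2[OF T_continuous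
          continuous_on_subset[OF solves_ode_on_continuous[OF W(1)]]]) (use W(2) \<eta> in auto)
  have "T (W 0) = T x" using T_eq_iff_indist[of x "W 0"] x W(2) \<eta> ind by simp
  then obtain d2 where d2: "d2 > 0" "\<And>t. t \<in> {0..\<eta>} \<Longrightarrow> dist t 0 < d2 \<Longrightarrow> dist (T (W t)) (T x) < d1"
    using TW d1(1) \<eta> unfolding continuous_on_iff by (metis atLeastAtMost_iff less_eq_real_def)
  have "- s \<in> {-\<eta>..\<eta>}" using s by auto
  then obtain d3 where d3: "d3 > 0"
    "\<And>u. u \<in> {-\<eta>..\<eta>} \<Longrightarrow> dist u (- s) < d3 \<Longrightarrow> dist (\<phi> u) (\<phi> (- s)) < r"
    using solves_ode_on_continuous[OF \<phi>(1)] r(1) unfolding continuous_on_iff by metis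
  define d where "d = min (min d2 d3) (min \<eta> s) / 2"
  have d: "d > 0" "d < d2" "d < d3" "d < \<eta>" "d < s"
    using d2(1) d3(1) \<eta> s(1) by (auto simp: d_def min_def)
  have "\<phi> t \<in> X" if t: "t \<in> {0..d}" for t
  proof -
    have t': "0 \<le> t" "t < \<eta>" "t < s" using t d by auto
    have WX: "W t \<in> X" using W(2) t' by auto
    have "dist (T (W t)) (T x) < d1" by (rule d2(2)) (use t d in auto)
    then obtain q where q: "q \<in> X" "T q = T (W t)" "dist q x < e"
      using d1(2) WX by (auto simp: fibre_def)
    have q\<rho>: "q \<in> ball x \<rho>" using q(3) by (simp add: e_def dist_commute)
    have sol_q: "solves_ode_on f (\<Phi> q) {-s..0}"
      by (rule solves_ode_on_subset[OF \<Phi>(4)[rule_format, OF q\<rho>]]) (use s in auto)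
    have sol_W: "solves_ode_on f (\<lambda>v. W (t + v)) {-s..0}"
      by (rule solves_ode_on_shift[OF W(1)]) (use t' s in auto)
    have sol_t: "solves_ode_on f (\<lambda>v. \<phi> (t + v)) {-s..0}"
      by (rule solves_ode_on_shift[OF \<phi>(1)]) (use t' s in auto)
    have "indist (\<Phi> q 0) (W (t + 0))"
      using T_eq_iff_indist[OF q(1) WX] q(2) \<Phi>(3) q\<rho> by simp
    from indist_propagate[OF sol_q sol_W _ _ this, of "- s"]
    have 1: "indist (\<Phi> q (- s)) (W (t - s))" using s(1) by simp
    have "indist (\<phi> 0) (W 0)" using ind \<phi>(2) by simp
    from indist_propagate[OF \<phi>(1) W(1) _ _ this, of "t - s"]
    have "indist (\<phi> (t - s)) (W (t - s))" using t' s \<eta> by auto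
    from indist_trans[OF 1 indist_sym[OF this]]
    have ind_s: "indist (\<Phi> q (- s)) (\<phi> (t - s))" .
    have "\<phi> (- s) = \<Phi> x (- s)"
      by (rule unique_solution[of _ "{-s..0}", OF solves_ode_on_subset[OF \<phi>(1)]
            solves_ode_on_subset[OF \<Phi>(4)[rule_format, of x]], where s = 0])
        (use \<Phi> \<phi>(2) s in auto)
    then have near_q: "dist (\<Phi> q (- s)) (\<phi> (- s)) < r"
      using \<Phi>(5)[rule_format, OF q\<rho>, of x "- s"] \<Phi>(1) s eK[of "q - x"] q(3)
      by (simp add: dist_norm)
    have near_t: "dist (\<phi> (t - s)) (\<phi> (- s)) < r"
      by (rule d3(2)) (use t' t d s \<eta> in \<open>auto simp: dist_norm\<close>)
    have in_X: "\<Phi> q (- s) \<in> X" "\<phi> (t - s) \<in> X"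
      using near_q near_t r(2) by (auto simp: dist_commute)
    have "dist (\<Phi> q (- s)) (\<phi> (t - s)) < r + r"
      using near_q near_t dist_triangle_less_add[of _ "\<phi> (- s)" r _ r] by (simp add: dist_commute)
    also have "\<dots> \<le> \<delta>" by (simp add: r_def)
    finally have "\<Phi> q (- s) = \<phi> (t - s)"
      using separated in_X T_eq_iff_indist[OF in_X] ind_s by blast
    \<comment> \<open>Equal at time \<open>- s\<close>, the two solutions are equal at time 0; hence
      \<open>\<phi> t\<close> is the fibre point q, which lies in X.\<close>
    then have "\<Phi> q 0 = \<phi> (t + 0)"
      by (intro unique_solution[where \<phi> = "\<Phi> q" and \<psi> = "\<lambda>v. \<phi> (t + v)" and t = 0, OF sol_q sol_t, of "- s"])
        (use s in auto)
    then show ?thesis using q(1) \<Phi>(3) q\<rho> by simp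
  qed
  then show ?thesis using that d(1) by blast
qed

lemma generating_solution_indist:
  assumes x1: "solves_ode_on f x1 {t0..}" "\<forall>t\<ge>t0. y t = h (x1 t)"
    and x: "x \<in> generating_solutions f h X y t0" and t: "t \<ge> t0"
  shows "indist (x t) (x1 t)"
proof (rule indist_propagate[where J = "{t0..}" and s = "t0 + 1"])
  have sol: "solves_ode_on f x {t0..}" and out: "\<forall>t\<ge>t0. h (x t) = y t"
    using x by (auto simp: generating_solutions_def)
  then show "solves_ode_on f x {t0..}" by simp
  \<comment> \<open>At \<open>t0\<close> itself no earlier outputs are compared. At
    \<open>t0 + 1\<close> the outputs agree over a past of length 1, and propagation carries the
    relation back to \<open>t0\<close>.\<close>
  show "indist (x (t0 + 1)) (x1 (t0 + 1))"
    by (rule indistI[where c = t0]) (use sol x1 out in \<open>auto intro: solves_ode_on_subset\<close>)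
qed (use x1 t in auto)

lemma generating_solution_eqI:
  assumes x: "x \<in> generating_solutions f h X y t0" and x': "x' \<in> generating_solutions f h X y t0"
    and t: "t \<ge> t0" "x t = x' t"
  shows "x = x'"
proof (rule PiE_ext)
  show "x \<in> {t0..} \<rightarrow>\<^sub>E X" "x' \<in> {t0..} \<rightarrow>\<^sub>E X" using x x' by (auto simp: generating_solutions_def)
  show "x s = x' s" if "s \<in> {t0..}" for s
    by (rule unique_solution[where J = "{t0..}" and s = t])
      (use x x' t that in \<open>auto simp: generating_solutions_def\<close>)
qed

context
  fixes x1 :: "real \<Rightarrow> real^'n" and y :: "real \<Rightarrow> real^'m" and tbar :: real
  assumes tbar_pos: "tbar > 0" and x1_solution: "solves_ode_on f x1 {0..}"
    and x1_output: "\<forall>t\<ge>tbar. y t = h (x1 t)" and x1_in_X: "\<forall>t\<ge>tbar. x1 t \<in> X"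
begin

lemma x1_solution_tbar: "solves_ode_on f x1 {tbar..}"
  by (rule solves_ode_on_subset[OF x1_solution]) (use tbar_pos in auto)

lemma generating_solution_T_eq:
  assumes "x \<in> generating_solutions f h X y tbar" "t \<ge> tbar"
  shows "x t \<in> X" "T (x t) = T (x1 t)"
proof -
  show xX: "x t \<in> X" using assms by (auto simp: generating_solutions_def PiE_iff)
  show "T (x t) = T (x1 t)"
    using T_eq_iff_indist[OF xX] x1_in_X assms
      generating_solution_indist[OF x1_solution_tbar x1_output assms] by blast
qed

lemma inj_on_generating_solutions: "inj_on (\<lambda>x. x tbar) (generating_solutions f h X y tbar)"
  by (intro inj_onI) (metis generating_solution_eqI order_refl)

lemma generating_solutions_initial:
  "(\<lambda>x. x tbar) ` generating_solutions f h X y tbar \<subseteq> fibre T X (T (x1 tbar))"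
  using generating_solution_T_eq[of _ tbar] by (auto simp: fibre_def)

lemma fibre_x1_card: "card (fibre T X (T (x1 tbar))) = p"
  using card_fibre x1_in_X by blast

lemma fibre_x1_finite: "finite (fibre T X (T (x1 tbar)))"
  using fibre_x1_card p_pos by (metis card.infinite less_irrefl)

lemma finite_generating_solutions: "finite (generating_solutions f h X y tbar)"
  using fibre_x1_finite generating_solutions_initial inj_on_generating_solutions
  by (metis finite_subset finite_imageD)

lemma card_generating_solutions_le: "card (generating_solutions f h X y tbar) \<le> p"
  using card_inj_on_le[OF inj_on_generating_solutions generating_solutions_initial fibre_x1_finite]
  by (simp add: fibre_x1_card)

lemma generating_solutions_not_convergent:
  assumes x: "x \<in> generating_solutions f h X y tbar" and x': "x' \<in> generating_solutions f h X y tbar"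
    and ne: "x \<noteq> x'"
  shows "\<not> ((\<lambda>t. x t - x' t) \<longlongrightarrow> 0) at_top"
proof
  assume "((\<lambda>t. x t - x' t) \<longlongrightarrow> 0) at_top"
  then have "\<forall>\<^sub>F t in at_top. dist (x t - x' t) 0 < \<delta>" using \<delta>_pos by (rule tendstoD)
  moreover have "\<forall>\<^sub>F t in at_top. t \<ge> tbar" by (rule eventually_ge_at_top)
  ultimately have "\<forall>\<^sub>F t in at_top. t \<ge> tbar \<and> dist (x t) (x' t) < \<delta>"
    by eventually_elim (simp add: dist_norm)
  then obtain t where t: "t \<ge> tbar" "dist (x t) (x' t) < \<delta>"
    using eventually_happens'[OF trivial_limit_at_top_linorder] by blast
  have "x t = x' t"
    using generating_solution_T_eq[OF x t(1)] generating_solution_T_eq[OF x' t(1)] t(2) by (intro separated) auto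
  then show False using generating_solution_eqI[OF x x' t(1)] ne by blast
qed

text \<open>Evaluation at tbar is injective into a fibre of p points, so the count is p once every
  fibre point starts a solution that never leaves X. Such a solution generates y because it is
  indistinguishable from x1. All three cases of (ii) thus reduce to the local condition
  \<open>ext\<close>.\<close>

lemma card_generating_solutions_eqI:
  assumes ext: "\<And>x0 \<tau> e x. x0 \<in> fibre T X (T (x1 tbar)) \<Longrightarrow> tbar \<le> \<tau> \<Longrightarrow> e > 0 \<Longrightarrow>
      solves_ode_on f x {tbar..\<tau> + e} \<Longrightarrow> x tbar = x0 \<Longrightarrow> (\<forall>t\<in>{tbar..\<tau>}. x t \<in> X) \<Longrightarrow>
      (\<forall>t\<in>{tbar..\<tau> + e}. indist (x t) (x1 t)) \<Longrightarrow>
      \<exists>d>0. d \<le> e \<and> (\<forall>t\<in>{\<tau>..\<tau> + d}. x t \<in> X)"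
  shows "card (generating_solutions f h X y tbar) = p"
proof -
  have "\<exists>x\<in>generating_solutions f h X y tbar. x tbar = x0" if x0: "x0 \<in> fibre T X (T (x1 tbar))" for x0
  proof -
    have x0X: "x0 \<in> X" and Tx0: "T x0 = T (x1 tbar)" using x0 by (auto simp: fibre_def)
    have ind0: "indist x0 (x1 tbar)" using T_eq_iff_indist[OF x0X] x1_in_X Tx0 by blast
    obtain x where x: "solves_ode_on f x {tbar..}" "x tbar = x0" "\<forall>t\<ge>tbar. x t \<in> X"
    proof (rule global_solution_in_compact[OF X_compact x0X, of tbar])
      fix \<tau> e x
      assume *: "tbar \<le> \<tau>" "0 < e" "solves_ode_on f x {tbar..\<tau> + e}" "x tbar = x0" "\<forall>t\<in>{tbar..\<tau>}. x t \<in> X"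
      have "indist (x t) (x1 t)" if "t \<in> {tbar..\<tau> + e}" for t
        by (rule indist_propagate[OF *(3), of _ tbar])
          (use * that ind0 in \<open>auto intro: solves_ode_on_subset[OF x1_solution_tbar]\<close>)
      then show "\<exists>d>0. d \<le> e \<and> (\<forall>t\<in>{\<tau>..\<tau> + d}. x t \<in> X)"
        using ext[OF x0 *] by blast
    qed blast
    have out: "h (x t) = y t" if "t \<ge> tbar" for t
    proof -
      have "indist (x t) (x1 t)"
        by (rule indist_propagate[OF x(1) x1_solution_tbar, of tbar]) (use that x ind0 in auto)
      then show ?thesis using indist_imp_h_eq x1_output that by fastforce
    qed
    have "solves_ode_on f (restrict x {tbar..}) {tbar..}"
      by (rule solves_ode_onI_local) (use x(1) in \<open>auto intro!: exI[of _ UNIV] exI[of _ x]\<close>)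
    then have "restrict x {tbar..} \<in> generating_solutions f h X y tbar"
      using x out by (auto simp: generating_solutions_def)
    then show ?thesis using x(2) by (intro bexI[of _ "restrict x {tbar..}"]) auto
  qed
  then have "(\<lambda>x. x tbar) ` generating_solutions f h X y tbar = fibre T X (T (x1 tbar))"
    using generating_solutions_initial by blast
  then show ?thesis
    using card_image[OF inj_on_generating_solutions] fibre_x1_card by simp
qed

lemma card_if_forward_invariant:
  assumes "forward_invariant f X"
  shows "card (generating_solutions f h X y tbar) = p"
proof (rule card_generating_solutions_eqI)
  fix \<tau> e and x :: "real \<Rightarrow> real^'n"
  assume *: "tbar \<le> \<tau>" "0 < e" "solves_ode_on f x {tbar..\<tau> + e}" "\<forall>t\<in>{tbar..\<tau>}. x t \<in> X"
  have "solves_ode_on f (\<lambda>t. x (tbar + t)) {0..\<tau> + e - tbar}"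
    by (rule solves_ode_on_shift[OF *(3)]) auto
  moreover have "0 \<le> \<tau> + e - tbar" "x (tbar + 0) \<in> X" using * by auto
  ultimately have inv: "\<forall>t\<in>{0..\<tau> + e - tbar}. x (tbar + t) \<in> X"
    using assms unfolding forward_invariant_def by blast
  have "x t \<in> X" if "t \<in> {\<tau>..\<tau> + e}" for t
    using bspec[OF inv, of "t - tbar"] that * by auto
  then show "\<exists>d>0. d \<le> e \<and> (\<forall>t\<in>{\<tau>..\<tau> + d}. x t \<in> X)" using *(2) by blast
qed

lemma solution_stays_in_open:
  assumes "solves_ode_on f x {tbar..\<tau> + e}" "tbar \<le> \<tau>" "e > 0" "open U" "x \<tau> \<in> U"
  obtains d where "d > 0" "d \<le> e" "\<forall>t\<in>{\<tau>..\<tau> + d}. x t \<in> U"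
proof -
  have "continuous_on {tbar..\<tau> + e} x" by (rule solves_ode_on_continuous[OF assms(1)])
  moreover obtain r where r: "r > 0" "ball (x \<tau>) r \<subseteq> U" using assms(4,5) by (meson open_contains_ball)
  moreover have "\<tau> \<in> {tbar..\<tau> + e}" using assms by auto
  ultimately obtain d where d: "d > 0"
    "\<And>t. t \<in> {tbar..\<tau> + e} \<Longrightarrow> dist t \<tau> < d \<Longrightarrow> dist (x t) (x \<tau>) < r"
    unfolding continuous_on_iff by metis
  have "x t \<in> U" if "t \<in> {\<tau>..\<tau> + min (d / 2) e}" for t
  proof -
    have "dist (x t) (x \<tau>) < r" by (rule d(2)) (use that assms d(1) in \<open>auto simp: dist_norm\<close>)
    then show ?thesis using r(2) by (auto simp: dist_commute)
  qed
  then show ?thesis using d(1) assms(3) by (intro that[of "min (d / 2) e"]) auto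
qed

text \<open>By continuity a solution cannot leave the interior of U at once, and while it is in U
  its states are indistinguishable from those of x1, which by \<open>ind\<close> puts them into
  X.\<close>

lemma card_if_no_indistinguishable_neighbour:
  assumes U: "X \<subseteq> interior U" and ind: "\<forall>t\<ge>tbar. indist_set f h U (x1 t) = indist_set f h X (x1 t)"
  shows "card (generating_solutions f h X y tbar) = p"
proof (rule card_generating_solutions_eqI)
  fix \<tau> e and x :: "real \<Rightarrow> real^'n"
  assume *: "tbar \<le> \<tau>" "0 < e" "solves_ode_on f x {tbar..\<tau> + e}" "\<forall>t\<in>{tbar..\<tau>}. x t \<in> X"
    and ix: "\<forall>t\<in>{tbar..\<tau> + e}. indist (x t) (x1 t)"
  have "x \<tau> \<in> interior U" using * U by auto
  obtain d where d: "d > 0" "d \<le> e" "\<forall>t\<in>{\<tau>..\<tau> + d}. x t \<in> interior U"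
    by (rule solution_stays_in_open[OF *(3,1,2) open_interior \<open>x \<tau> \<in> interior U\<close>])
  have "x t \<in> X" if t: "t \<in> {\<tau>..\<tau> + d}" for t
  proof -
    have "x t \<in> U" using d(3) t interior_subset by blast
    then have "x t \<in> indist_set f h U (x1 t)"
      using d(2) t *(1) ix by (auto simp: indist_set_def backward_indistinguishable_iff)
    moreover have "indist_set f h U (x1 t) = indist_set f h X (x1 t)" using ind t *(1) by simp
    ultimately have "x t \<in> indist_set f h X (x1 t)" by simp
    then show ?thesis by (simp add: indist_set_def)
  qed
  with d show "\<exists>d>0. d \<le> e \<and> (\<forall>t\<in>{\<tau>..\<tau> + d}. x t \<in> X)" by blast
qed

text \<open>At a boundary point the solution either enters the interior directly or has come from
  it, in which case \<open>stays_if_comes_from_interior\<close> applies. After tbar it has come from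
  the interior; at tbar the cone condition decides between the two.\<close>

lemma card_if_transversal:
  assumes cone: "\<forall>x\<in>fibre T X (T (x1 tbar)). {f x, - f x} \<inter> contingent_cone X x \<noteq> {}"
    and transversal: "\<forall>x\<in>frontier X. {- f x, f x} \<inter> contingent_cone (frontier X) x = {}"
  shows "card (generating_solutions f h X y tbar) = p"
proof (rule card_generating_solutions_eqI)
  fix x0 \<tau> e and x :: "real \<Rightarrow> real^'n"
  assume x0: "x0 \<in> fibre T X (T (x1 tbar))"
    and \<tau>: "tbar \<le> \<tau>" and e: "0 < e" and sol: "solves_ode_on f x {tbar..\<tau> + e}" and xt: "x tbar = x0"
    and in_X: "\<forall>t\<in>{tbar..\<tau>}. x t \<in> X" and ix: "\<forall>t\<in>{tbar..\<tau> + e}. indist (x t) (x1 t)"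
  have closed: "closed X" using X_compact by (rule compact_imp_closed)
  show "\<exists>d>0. d \<le> e \<and> (\<forall>t\<in>{\<tau>..\<tau> + d}. x t \<in> X)"
  proof (cases "x \<tau> \<in> interior X")
    case True
    obtain d where "d > 0" "d \<le> e" "\<forall>t\<in>{\<tau>..\<tau> + d}. x t \<in> interior X"
      by (rule solution_stays_in_open[OF sol \<tau> e open_interior True])
    then show ?thesis using interior_subset by blast
  next
    case False
    have x\<tau>: "x \<tau> \<in> X" using in_X \<tau> by auto
    then have fr: "x \<tau> \<in> frontier X" using False closed by (simp add: frontier_def)
    \<comment> \<open>A two-sided solution is needed: when \<open>\<tau> = tbar\<close>, x has no
      past of its own.\<close>
    obtain \<epsilon> \<phi> where \<phi>0: "\<epsilon> > 0" "\<phi> 0 = x \<tau>" "solves_ode_on f \<phi> {-\<epsilon><..<\<epsilon>}"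
      by (rule local_solution[of "x \<tau>"])
    \<comment> \<open>The bound by tbar keeps \<open>\<tau> - \<eta>\<close> nonnegative, so that x1
      is a solution on the whole window around \<open>\<tau>\<close>.\<close>
    define \<eta> where "\<eta> = min (\<epsilon> / 2) (min e tbar)"
    have \<eta>: "\<eta> > 0" "\<eta> < \<epsilon>" "\<eta> \<le> e" "\<eta> \<le> tbar" using \<phi>0 e tbar_pos by (auto simp: \<eta>_def)
    have \<phi>: "solves_ode_on f \<phi> {-\<eta>..\<eta>}" using \<eta> by (intro solves_ode_on_subset[OF \<phi>0(3)]) auto
    have W: "solves_ode_on f (\<lambda>t. x1 (\<tau> + t)) {-\<eta>..\<eta>}"
      by (rule solves_ode_on_shift[OF x1_solution]) (use \<eta> \<tau> in auto)
    have WX: "\<forall>t\<in>{0..\<eta>}. x1 (\<tau> + t) \<in> X" using x1_in_X \<tau> by auto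
    have ind: "indist (x \<tau>) (x1 (\<tau> + 0))" using ix \<tau> e by simp
    have x_\<phi>: "x (\<tau> + t) = \<phi> t" if "t \<in> {0..\<eta>}" for t
    proof (rule unique_solution[where J = "{0..\<eta>}" and s = 0 and \<phi> = "\<lambda>t. x (\<tau> + t)"])
      show "solves_ode_on f (\<lambda>t. x (\<tau> + t)) {0..\<eta>}"
        by (rule solves_ode_on_shift[OF sol]) (use \<tau> \<eta> in auto)
      show "solves_ode_on f \<phi> {0..\<eta>}" by (rule solves_ode_on_subset[OF \<phi>]) (use \<eta> in auto)
    qed (use that \<eta> \<phi>0 in auto)
    have conclude: ?thesis if "d > 0" "\<forall>t\<in>{0..d}. \<phi> t \<in> X" for d
    proof (intro exI[of _ "min d \<eta>"] conjI ballI)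
      fix t assume "t \<in> {\<tau>..\<tau> + min d \<eta>}"
      then show "x t \<in> X" using x_\<phi>[of "t - \<tau>"] that(2) by auto
    qed (use that \<eta> in auto)
    have from_interior: ?thesis if int: "\<forall>\<^sub>F s in at_right 0. \<phi> (- s) \<in> interior X"
    proof -
      obtain d where "d > 0" "\<forall>t\<in>{0..d}. \<phi> t \<in> X"
        by (rule stays_if_comes_from_interior[OF x\<tau> \<eta>(1) W WX ind \<phi> \<phi>0(2) int])
      then show ?thesis by (rule conclude)
    qed
    have at0: "(\<phi> has_vector_derivative f (x \<tau>)) (at 0)"
    proof -
      have "(\<phi> has_vector_derivative f (\<phi> 0)) (at 0 within {-\<epsilon><..<\<epsilon>})"
        using \<phi>0(1) by (intro \<phi>0(3)[unfolded solves_ode_on_def, rule_format]) simp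
      moreover have "at 0 within {-\<epsilon><..<\<epsilon>} = at 0" using \<phi>0(1) by (intro at_within_open) auto
      ultimately show ?thesis using \<phi>0(2) by simp
    qed
    then have fwd: "(\<phi> has_vector_derivative f (x \<tau>)) (at 0 within {0..\<eta>})"
      by (rule has_vector_derivative_at_within)
    have uminus_der: "(uminus has_vector_derivative (-1::real)) (at (0::real))"
      by (auto intro!: derivative_eq_intros)
    have "((\<phi> \<circ> uminus) has_vector_derivative (-1) *\<^sub>R f (x \<tau>)) (at 0)"
      by (rule vector_diff_chain_at) (use at0 in \<open>simp_all add: uminus_der\<close>)
    then have bwd: "((\<lambda>s. \<phi> (- s)) has_vector_derivative - f (x \<tau>)) (at 0 within {0..\<eta>})"
      unfolding o_def scaleR_minus_left scaleR_one by (rule has_vector_derivative_at_within)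
    have notin: "f (x \<tau>) \<notin> contingent_cone (frontier X) (x \<tau>)" "- f (x \<tau>) \<notin> contingent_cone (frontier X) (x \<tau>)"
      using transversal fr by auto
    have cont: "continuous_on {-\<eta>..\<eta>} \<phi>" by (rule solves_ode_on_continuous[OF \<phi>])
    show ?thesis
    proof (cases "\<tau> = tbar")
      case True
      then consider "f (x \<tau>) \<in> contingent_cone X (x \<tau>)" | "- f (x \<tau>) \<in> contingent_cone X (x \<tau>)"
        using cone x0 xt by blast
      then show ?thesis
      proof cases
        case 1
        have "continuous_on {0..\<eta>} \<phi>" by (rule continuous_on_subset[OF cont]) auto
        then obtain d where d: "d > 0" "d \<le> \<eta>" "\<forall>s\<in>{0<..<d}. \<phi> s \<in> interior X"
          using enters_if_in_contingent_cone[OF fwd \<eta>(1) _ closed] x\<tau> \<phi>0(2) 1 notin(1) by metis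
        have "\<phi> t \<in> X" if "t \<in> {0..d / 2}" for t
          using d that x\<tau> \<phi>0(2) interior_subset[of X] by (cases "t = 0") auto
        then show ?thesis using conclude[of "d / 2"] d(1) by auto
      next
        case 2
        have "continuous_on {0..\<eta>} (\<lambda>s. \<phi> (- s))"
          by (rule continuous_on_compose2[OF cont]) (auto intro!: continuous_intros)
        then obtain d where d: "d > 0" "d \<le> \<eta>" "\<forall>s\<in>{0<..<d}. \<phi> (- s) \<in> interior X"
          using enters_if_in_contingent_cone[OF bwd \<eta>(1) _ closed] x\<tau> \<phi>0(2) 2 notin(2)
          by (metis minus_zero)
        then show ?thesis
          by (intro from_interior) (auto simp: eventually_at_right_field)
      qed
    next
      case False
      define \<eta>' where "\<eta>' = min \<eta> (\<tau> - tbar)"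
      have \<eta>': "\<eta>' > 0" "\<eta>' \<le> \<eta>" "\<eta>' \<le> \<tau> - tbar" using False \<tau> \<eta> by (auto simp: \<eta>'_def)
      \<comment> \<open>After tbar, \<open>\<phi>\<close> retraces x backward and so stays in X.
        Since \<open>- f\<close> is not tangent to the frontier, this past avoids the frontier and
        lies in the interior.\<close>
      have back_X: "\<phi> (- s) \<in> X" if "0 < s" "s < \<eta>'" for s
      proof -
        have "\<phi> (- s) = x (\<tau> + (- s))"
        proof (rule unique_solution[where J = "{-\<eta>'..0}" and s = 0 and \<psi> = "\<lambda>t. x (\<tau> + t)"])
          show "solves_ode_on f (\<lambda>t. x (\<tau> + t)) {-\<eta>'..0}"
            by (rule solves_ode_on_shift[OF sol]) (use \<eta>' e in auto)
          show "solves_ode_on f \<phi> {-\<eta>'..0}" by (rule solves_ode_on_subset[OF \<phi>]) (use \<eta>' \<eta> in auto)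
        qed (use that \<eta>' \<phi>0 in auto)
        then show ?thesis using in_X that \<eta>' by auto
      qed
      have "\<forall>\<^sub>F s in at_right 0. \<phi> (- s) \<notin> frontier X"
        using avoids_if_not_in_contingent_cone[OF bwd \<eta>(1)] notin(2) \<phi>0(2) by simp
      moreover have "\<forall>\<^sub>F s in at_right 0. \<phi> (- s) \<in> X"
        unfolding eventually_at_right_field using back_X \<eta>'(1) by blast
      ultimately have "\<forall>\<^sub>F s in at_right 0. \<phi> (- s) \<in> interior X"
        by eventually_elim (use closed in \<open>simp add: frontier_def\<close>)
      then show ?thesis by (rule from_interior)
    qed
  qed
qed

end

end

theorem proposition1:
  fixes f :: "real^'n \<Rightarrow> real^'n"
    and h :: "real^'n \<Rightarrow> real^'m"
    and T :: "real^'n \<Rightarrow> real^'k"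
    and DT :: "real^'n \<Rightarrow> real^'n^'k"
    and \<O> X :: "(real^'n) set"
    and p :: nat
    and y :: "real \<Rightarrow> real^'m"
    and x1 :: "real \<Rightarrow> real^'n"
    and tbar :: real
  assumes f_analytic: "real_analytic f"
    and h_analytic: "real_analytic h"
    and T_C1: "C1_on_with_jacobian T DT \<O>"
    and X_compact: "compact X"
    and X_subset: "X \<subseteq> \<O>"
    and p_pos: "p \<ge> 1"
    and A1: "\<forall>z\<in>T ` X. card (fibre T X z) = p"
    and A2: "\<forall>x\<in>X. rank (DT x) = CARD('n)"
    and A3: "\<forall>x\<^sub>a\<in>X. \<forall>x\<^sub>b\<in>X. T x\<^sub>a = T x\<^sub>b \<longleftrightarrow> backward_indistinguishable f h x\<^sub>a x\<^sub>b"
    and tbar_pos: "tbar > 0"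
    and x1_solution: "solves_ode_on f x1 {0..}"
    and x1_output: "\<forall>t\<ge>tbar. y t = h (x1 t)"
    and x1_in_X: "\<forall>t\<ge>tbar. x1 t \<in> X"
  shows
    "(finite (generating_solutions f h X y tbar) \<and>
      card (generating_solutions f h X y tbar) \<le> p \<and>
      (\<forall>x\<in>generating_solutions f h X y tbar. \<forall>x'\<in>generating_solutions f h X y tbar.
         x \<noteq> x' \<longrightarrow> \<not> ((\<lambda>t. x t - x' t) \<longlongrightarrow> 0) at_top))
     \<and>
     (forward_invariant f X
      \<or> (\<exists>\<U>. X \<subseteq> interior \<U> \<and>
            (\<forall>t\<ge>tbar. indist_set f h \<U> (x1 t) = indist_set f h X (x1 t)))
      \<or> ((\<forall>x\<in>fibre T X (T (x1 tbar)). {f x, - f x} \<inter> contingent_cone X x \<noteq> {}) \<and>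
          (\<forall>x\<in>frontier X. {- f x, f x} \<inter> contingent_cone (frontier X) x = {}))
      \<longrightarrow> card (generating_solutions f h X y tbar) = p)"
proof -
  interpret analytic_system f h
    using f_analytic h_analytic by unfold_locales
  obtain \<delta> where \<delta>: "\<delta> > 0" "\<forall>x\<in>X. \<forall>x'\<in>X. T x = T x' \<longrightarrow> dist x x' < \<delta> \<longrightarrow> x = x'"
    by (rule uniformly_locally_injective[OF T_C1 X_compact X_subset A2])
  interpret indistinguishability_map f h T X p \<delta>
  proof unfold_locales
    show "card (fibre T X z) = p" if "z \<in> T ` X" for z using A1 that by (rule bspec)
    show "x = x'" if "x \<in> X" "x' \<in> X" "T x = T x'" "dist x x' < \<delta>" for x x'
      using \<delta>(2) that by simp
    show "continuous_on X T" by (rule C1_on_with_jacobian_continuous[OF T_C1 X_subset])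
    show "T x = T x' \<longleftrightarrow> indist x x'" if "x \<in> X" "x' \<in> X" for x x'
      using A3 that by (simp add: backward_indistinguishable_iff)
  qed (use X_compact p_pos \<delta>(1) in simp_all)
  note hyps = tbar_pos x1_solution x1_output x1_in_X
  show ?thesis
  proof (intro conjI impI)
    show "finite (generating_solutions f h X y tbar)" by (rule finite_generating_solutions[OF hyps])
    show "card (generating_solutions f h X y tbar) \<le> p" by (rule card_generating_solutions_le[OF hyps])
    show "\<forall>x\<in>generating_solutions f h X y tbar. \<forall>x'\<in>generating_solutions f h X y tbar.
         x \<noteq> x' \<longrightarrow> \<not> ((\<lambda>t. x t - x' t) \<longlongrightarrow> 0) at_top"
      using generating_solutions_not_convergent[OF hyps] by simp
    assume "forward_invariant f X
      \<or> (\<exists>\<U>. X \<subseteq> interior \<U> \<and>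
            (\<forall>t\<ge>tbar. indist_set f h \<U> (x1 t) = indist_set f h X (x1 t)))
      \<or> ((\<forall>x\<in>fibre T X (T (x1 tbar)). {f x, - f x} \<inter> contingent_cone X x \<noteq> {}) \<and>
          (\<forall>x\<in>frontier X. {- f x, f x} \<inter> contingent_cone (frontier X) x = {}))"
    then show "card (generating_solutions f h X y tbar) = p"
    proof (elim disjE exE conjE)
      assume "forward_invariant f X"
      then show ?thesis by (rule card_if_forward_invariant[OF hyps])
    next
      fix U assume "X \<subseteq> interior U" "\<forall>t\<ge>tbar. indist_set f h U (x1 t) = indist_set f h X (x1 t)"
      then show ?thesis by (rule card_if_no_indistinguishable_neighbour[OF hyps])
    next
      assume "\<forall>x\<in>fibre T X (T (x1 tbar)). {f x, - f x} \<inter> contingent_cone X x \<noteq> {}"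
        "\<forall>x\<in>frontier X. {- f x, f x} \<inter> contingent_cone (frontier X) x = {}"
      then show ?thesis by (rule card_if_transversal[OF hyps])
    qed
  qed
qed

end
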